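(* Let $A\in\mathbb{R}^{m\times n}$ be a mean-centred matrix (its rows sum to zero), let $1\le p\le n$, and let $\mathrm{St}(n,p)$ be the set of $n\times p$ real matrices with orthonormal columns. For $q\in\{1,\dots,p\}$ let $$f_{s_q}(X)=\frac{s_q(X^*A^*AX)}{s_q(X^*X)},$$ where $s_q(B)=\sum_{1\le i_1<\cdots<i_q\le p}\prod_{j=1}^q\lambda_{B,i_j}$ is the $q$-th elementary symmetric polynomial of the eigenvalues $\lambda_{B,1},\dots,\lambda_{B,p}$ of a symmetric matrix $B\in\mathbb{R}^{p\times p}$. Consider the program $\arg\max\{f_{s_q}(X): X\in\mathrm{St}(n,p)\}$. For every $q\in\{1,\dots,p\}$, the following statements hold true: (i) $\widetilde X\in\mathbb{R}^{n\times p}$ is a global maximiser of the program if and only if there exists a $p$-leading right singular factor $V_p\in\mathbb{R}^{n\times p}$ of $A$ such that $\operatorname{range}(\widetilde X)=\operatorname{range}(V_p)$. (ii) The program does not have any spurious local optima, namely, any local maximum or minimum of $f_{s_q}$ on $\mathrm{St}(n,p)$ is also a global maximum or minimum, respectively, and all other stationary points are strict saddle points.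
   Context: $X^*$ denotes the transpose of $X$; $\operatorname{range}(X)$ is the column span of $X$. A $p$-leading right singular factor of $A$ is an $n\times p$ matrix with orthonormal columns consisting of $p$ leading right singular vectors of $A$, i.e. right singular vectors of $A$ (eigenvectors of $A^*A$) corresponding to its $p$ largest singular values (counted with multiplicity). In (i), a global maximiser is in particular an element of the feasible set $\mathrm{St}(n,p)$. A stationary point is $X_s\in\mathrm{St}(n,p)$ for which there is a symmetric $\Lambda_s\in\mathbb{R}^{p\times p}$ with $\nabla f_{s_q}(X_s)+2X_s\Lambda_s=0$, i.e. $\nabla f_{s_q}(X_s)$ is normal to the Stiefel manifold at $X_s$ (equivalently, a critical point of the restriction of $f_{s_q}$ to $\mathrm{St}(n,p)$). An ascent direction at a stationary point $X_s$ is a tangent direction $\Delta$ (i.e. $X_s^*\Delta+\Delta^*X_s=0$) along which the second-order variation of $f_{s_q}$ restricted to $\mathrm{St}(n,p)$ (equivalently, of the Lagrangian $f_{s_q}(X)+\langle X^*X-I_p,\Lambda_s\rangle$) is strictly positive. A saddle point is strict if it has an ascent direction.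
   Formalization: The "only if" part of (i) is stated for q ≤ rank A, A = 0 or p = n; in all other cases (0 < rank A < q, p < n) it is false, since f vanishes on St(n,p), e.g. A with rows (1,0,0), (−1,0,0), p = q = 2, X = [e2 e3]. *)

theory Defs
  imports "HOL-Analysis.Analysis" "HOL-Computational_Algebra.Polynomial"
begin

definition char_polynomial :: "real^'k^'k \<Rightarrow> real poly" where
  "char_polynomial B = det (mat [:0, 1:] - map_matrix (\<lambda>c. [:c:]) B)"

text \<open>Real eigenvalues with algebraic multiplicity, in decreasing order.  For a symmetric
  matrix all complex eigenvalues are real, so the list has length \<open>CARD('k)\<close>; the notions
  below apply it to symmetric matrices only.\<close>

definition eigenvalue_list :: "real^'k^'k \<Rightarrow> real list" where
  "eigenvalue_list B = rev (sorted_list_of_multiset (proots (char_polynomial B)))"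

definition sym_eig :: "nat \<Rightarrow> real^'k^'k \<Rightarrow> real" where
  "sym_eig q B = (\<Sum>I | I \<subseteq> {..<CARD('k)} \<and> card I = q. \<Prod>i\<in>I. eigenvalue_list B ! i)"

definition stiefel :: "(real^'p^'n) set" where
  "stiefel = {X. transpose X ** X = mat 1}"

definition col_range :: "real^'p^'n \<Rightarrow> (real^'n) set" where
  "col_range X = span (columns X)"

definition mean_centred :: "real^'n^'m \<Rightarrow> bool" where
  "mean_centred A \<longleftrightarrow> (\<Sum>i\<in>UNIV. row i A) = 0"

definition objective :: "real^'n^'m \<Rightarrow> nat \<Rightarrow> real^'p^'n \<Rightarrow> real" where
  "objective A q X =
     sym_eig q (transpose X ** transpose A ** A ** X) / sym_eig q (transpose X ** X)"

text \<open>The \<open>n\<close> singular values of an \<open>m \<times> n\<close> matrix in decreasing order (padded by zeros if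
  \<open>m < n\<close>), matching a full orthonormal system of \<open>n\<close> right singular vectors.\<close>

definition singular_values :: "real^'n^'m \<Rightarrow> real list" where
  "singular_values A = map sqrt (eigenvalue_list (transpose A ** A))"

text \<open>The bijection \<open>\<sigma>\<close> assigns the \<open>p\<close> largest singular values, with multiplicity, to the
  columns in any order.\<close>

definition leading_right_singular_factor :: "real^'n^'m \<Rightarrow> real^'p^'n \<Rightarrow> bool" where
  "leading_right_singular_factor A V \<longleftrightarrow> V \<in> stiefel \<and>
     (\<exists>\<sigma> :: 'p \<Rightarrow> nat. bij_betw \<sigma> UNIV {..<CARD('p)} \<and>
        (\<forall>j. (transpose A ** A) *v column j V = (singular_values A ! \<sigma> j)\<^sup>2 *\<^sub>R column j V))"

definition global_max :: "real^'n^'m \<Rightarrow> nat \<Rightarrow> real^'p^'n \<Rightarrow> bool" where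
  "global_max A q X \<longleftrightarrow> is_arg_max (objective A q) (\<lambda>Y. Y \<in> stiefel) X"

definition global_min :: "real^'n^'m \<Rightarrow> nat \<Rightarrow> real^'p^'n \<Rightarrow> bool" where
  "global_min A q X \<longleftrightarrow> is_arg_min (objective A q) (\<lambda>Y. Y \<in> stiefel) X"

definition local_max :: "real^'n^'m \<Rightarrow> nat \<Rightarrow> real^'p^'n \<Rightarrow> bool" where
  "local_max A q X \<longleftrightarrow> X \<in> stiefel \<and>
     (\<forall>\<^sub>F Y in at X within stiefel. objective A q Y \<le> objective A q X)"

definition local_min :: "real^'n^'m \<Rightarrow> nat \<Rightarrow> real^'p^'n \<Rightarrow> bool" where
  "local_min A q X \<longleftrightarrow> X \<in> stiefel \<and>
     (\<forall>\<^sub>F Y in at X within stiefel. objective A q X \<le> objective A q Y)"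

text \<open>The inner product of \<open>real^'p^'n\<close> is the Frobenius one, so \<open>GDERIV\<close> yields the
  Euclidean gradient as a matrix.\<close>

definition lagrange_multiplier :: "real^'n^'m \<Rightarrow> nat \<Rightarrow> real^'p^'n \<Rightarrow> real^'p^'p \<Rightarrow> bool" where
  "lagrange_multiplier A q X \<Lambda> \<longleftrightarrow> transpose \<Lambda> = \<Lambda> \<and>
     (\<exists>G. GDERIV (objective A q) X :> G \<and> G + 2 *\<^sub>R (X ** \<Lambda>) = 0)"

definition stationary :: "real^'n^'m \<Rightarrow> nat \<Rightarrow> real^'p^'n \<Rightarrow> bool" where
  "stationary A q X \<longleftrightarrow> X \<in> stiefel \<and> (\<exists>\<Lambda>. lagrange_multiplier A q X \<Lambda>)"

definition lagrangian :: "real^'n^'m \<Rightarrow> nat \<Rightarrow> real^'p^'p \<Rightarrow> real^'p^'n \<Rightarrow> real" where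
  "lagrangian A q \<Lambda> X = objective A q X + (transpose X ** X - mat 1) \<bullet> \<Lambda>"

text \<open>\<open>D\<close> below is the second derivative at \<open>t = 0\<close> of the Lagrangian along \<open>X + t \<Delta>\<close>.  As
  \<open>\<Delta>\<close> is tangent and \<open>X\<close> is stationary with multiplier \<open>\<Lambda>\<close>, it is also the second derivative
  of the objective along any curve in the Stiefel manifold through \<open>X\<close> with velocity \<open>\<Delta>\<close>.\<close>

definition ascent_direction :: "real^'n^'m \<Rightarrow> nat \<Rightarrow> real^'p^'n \<Rightarrow> real^'p^'n \<Rightarrow> bool" where
  "ascent_direction A q X \<Delta> \<longleftrightarrow>
     transpose X ** \<Delta> + transpose \<Delta> ** X = 0 \<and>
     (\<exists>\<Lambda> \<phi> D. lagrange_multiplier A q X \<Lambda> \<and>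
        (\<forall>\<^sub>F t in nhds 0. ((\<lambda>t. lagrangian A q \<Lambda> (X + t *\<^sub>R \<Delta>)) has_real_derivative \<phi> t) (at t)) \<and>
        (\<phi> has_real_derivative D) (at 0) \<and> D > 0)"

definition saddle_point :: "real^'n^'m \<Rightarrow> nat \<Rightarrow> real^'p^'n \<Rightarrow> bool" where
  "saddle_point A q X \<longleftrightarrow> stationary A q X \<and> \<not> local_max A q X \<and> \<not> local_min A q X"

definition strict_saddle_point :: "real^'n^'m \<Rightarrow> nat \<Rightarrow> real^'p^'n \<Rightarrow> bool" where
  "strict_saddle_point A q X \<longleftrightarrow> saddle_point A q X \<and> (\<exists>\<Delta>. ascent_direction A q X \<Delta>)"

end

(*
  Write M for A^T A and N(X) for s_q(X^T M X), so that the objective is N divided by a binomial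
  coefficient on the Stiefel manifold.  Since s_q is invariant under orthogonal conjugation, one may
  replace X by X U and assume that X^T M X = diag(b).  Rotating the column x_i towards a unit normal
  vector y changes N to first order by 2 (y . M x_i) e_i, where e_i is the elementary symmetric
  polynomial of degree q - 1 in the other b_j.  If N(X) > 0 then all e_i are positive, so at a critical
  point the columns are eigenvectors of M.  Rotating x_i towards a normal eigenvector with eigenvalue
  mu by the angle t changes N by exactly sin(t)^2 e_i (mu - b_i).  Hence at a local maximum every
  normal eigenvalue is at most every b_i, and then a dimension count shows that the columns of
  any competitor can be matched with those of X so that the b_i dominate: X is a global maximum, and
  its range is spanned by leading eigenvectors.  Local minima are the same with -M, a violated
  inequality gives an ascent direction, and points with N(X) = 0 are global minima, which for
  q at most the rank of A are limits of points with N > 0.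
*)
theory Submission
  imports Defs
begin

section \<open>Symmetric matrices and orthonormal systems\<close>

text \<open>Eigenvalues read from a sorted list need not be differentiable where they coincide, so
  the variations treat \<open>sym_eig\<close> as a whole: on symmetric matrices it is a polynomial
  in the entries, and at a diagonal matrix its first derivative sees only the diagonal of the
  velocity. This is the reason for diagonalising the compression before anything is varied.

  Dominance is recorded as an invariant subspace with a threshold that separates the quadratic form
  on it from the form on its complement, not as a list of eigenvectors. In this form it can be
  checked on normal eigenvectors alone, makes sense for -M, and copes with ties between chosen and
  discarded eigenvalues.

  Ascent directions need more than rotations: they are measured by the Lagrangian along a straight
  line, which leaves the Stiefel manifold, so that the denominator of the objective varies as well
  and an entry of the multiplier has to be computed.\<close>

definition orthonormal_on :: "'i set \<Rightarrow> ('i \<Rightarrow> 'a::real_inner) \<Rightarrow> bool" where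
  "orthonormal_on I x \<longleftrightarrow> (\<forall>i\<in>I. \<forall>j\<in>I. x i \<bullet> x j = (if i = j then 1 else 0))"

lemma symmetric_dot:
  fixes M :: "real^'n^'n"
  assumes "transpose M = M"
  shows "(M *v x) \<bullet> y = x \<bullet> (M *v y)"
  by (subst assms[symmetric], subst transpose_matrix_vector, rule dot_lmul_matrix)

lemma form_diff_expand:
  fixes M :: "real^'n^'n"
  assumes "transpose M = M"
  shows "(y + t *\<^sub>R z) \<bullet> (M *v (y + t *\<^sub>R z)) =
    y \<bullet> (M *v y) + 2 * t * (z \<bullet> (M *v y)) + t\<^sup>2 * (z \<bullet> (M *v z))"
  using symmetric_dot[OF assms, of y z]
  by (simp add: matrix_vector_right_distrib matrix_vector_mult_scaleR inner_add_left inner_add_right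
      power2_eq_square inner_commute algebra_simps)

text \<open>The maximiser of the form on the compact unit sphere of \<open>W\<close> is an
  eigenvector: otherwise the residual \<open>z\<close>, which lies in \<open>W\<close> by
  invariance, would be a direction of first-order increase. The bound on all of \<open>W\<close> is
  exported because it later controls the form on an orthogonal complement.\<close>

lemma rayleigh_max:
  fixes M :: "real^'n^'n"
  assumes M: "transpose M = M" and W: "subspace W" "W \<noteq> {0}"
    and inv: "\<And>x. x \<in> W \<Longrightarrow> M *v x \<in> W"
  obtains y \<mu> where "y \<in> W" "norm y = 1" "M *v y = \<mu> *\<^sub>R y"
    "\<And>v. v \<in> W \<Longrightarrow> v \<bullet> (M *v v) \<le> \<mu> * (v \<bullet> v)"
proof -
  let ?K = "W \<inter> sphere 0 1"
  obtain w where w: "w \<in> W" "w \<noteq> 0"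
    using W subspace_0 by blast
  have "w /\<^sub>R norm w \<in> ?K"
    using w W by (simp add: subspace_scale)
  then have ne: "?K \<noteq> {}" by blast
  have "compact ?K"
    using W(1) by (simp add: closed_subspace closed_Int_compact)
  moreover have "continuous_on ?K (\<lambda>v. v \<bullet> (M *v v))"
    by (intro continuous_intros matrix_vector_mult_linear_continuous_on)
  ultimately obtain y where y: "y \<in> ?K" and ymax: "\<And>v. v \<in> ?K \<Longrightarrow> v \<bullet> (M *v v) \<le> y \<bullet> (M *v y)"
    using continuous_attains_sup[OF _ ne] by blast
  define \<mu> where "\<mu> = y \<bullet> (M *v y)"
  have yy: "y \<in> W" "y \<bullet> y = 1" using y by (auto simp: dot_square_norm)
  have bound: "v \<bullet> (M *v v) \<le> \<mu> * (v \<bullet> v)" if "v \<in> W" for v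
  proof (cases "v = 0")
    case False
    have "v /\<^sub>R norm v \<in> ?K" using that False W by (simp add: subspace_scale)
    then have "(v /\<^sub>R norm v) \<bullet> (M *v (v /\<^sub>R norm v)) \<le> \<mu>"
      unfolding \<mu>_def by (rule ymax)
    then have "norm v * norm v * ((v /\<^sub>R norm v) \<bullet> (M *v (v /\<^sub>R norm v))) \<le> norm v * norm v * \<mu>"
      by (intro mult_left_mono) auto
    moreover have "(v /\<^sub>R norm v) \<bullet> (M *v (v /\<^sub>R norm v)) = (v \<bullet> (M *v v)) / (norm v * norm v)"
      by (simp add: matrix_vector_mult_scaleR divide_inverse)
    ultimately show ?thesis
      using False by (simp add: dot_square_norm power2_eq_square pos_divide_le_eq)
  qed simp
  define z where "z = M *v y - \<mu> *\<^sub>R y"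
  have zW: "z \<in> W"
    unfolding z_def using W yy inv by (intro subspace_diff subspace_scale) auto
  define a where "a = z \<bullet> z"
  define c where "c = \<mu> * a - z \<bullet> (M *v z)"
  have c0: "c \<ge> 0" using bound[OF zW] by (simp add: c_def a_def)
  have a0: "a \<ge> 0" by (simp add: a_def)
  have ineq: "2 * t * a \<le> t\<^sup>2 * c" for t
  proof -
    have in_W: "y + t *\<^sub>R z \<in> W" using W yy zW by (intro subspace_add subspace_scale) auto
    have 1: "(y + t *\<^sub>R z) \<bullet> (y + t *\<^sub>R z) = 1 + 2 * t * (z \<bullet> y) + t\<^sup>2 * a"
      using yy by (simp add: inner_add_left inner_add_right a_def power2_eq_square inner_commute algebra_simps)
    have 2: "z \<bullet> (M *v y) - \<mu> * (z \<bullet> y) = a"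
      by (simp add: a_def z_def inner_diff_right)
    have "\<mu> + 2 * t * (z \<bullet> (M *v y)) + t\<^sup>2 * (z \<bullet> (M *v z)) \<le> \<mu> * (1 + 2 * t * (z \<bullet> y) + t\<^sup>2 * a)"
      using bound[OF in_W] unfolding form_diff_expand[OF M] 1 \<mu>_def .
    then have "2 * t * (z \<bullet> (M *v y) - \<mu> * (z \<bullet> y)) \<le> t\<^sup>2 * (\<mu> * a - z \<bullet> (M *v z))"
      by (simp add: algebra_simps)
    then show ?thesis unfolding 2 c_def .
  qed
  have "a = 0"
  proof (rule ccontr)
    assume "a \<noteq> 0"
    with a0 have ap: "a > 0" by simp
    \<comment> \<open>The step length a / (c + 1) makes the linear gain exceed the quadratic loss;
      the added 1 keeps the denominator positive when \<open>c\<close> is 0.\<close>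
    have "2 * (a / (c + 1)) * a \<le> (a / (c + 1))\<^sup>2 * c" by (rule ineq)
    then have "2 * (c + 1) * a\<^sup>2 \<le> a\<^sup>2 * c"
      using c0 by (simp add: power2_eq_square divide_simps split: if_splits) (simp add: algebra_simps)
    then show False using ap c0 by (simp add: mult.commute[of _ "a\<^sup>2"])
  qed
  then have "M *v y = \<mu> *\<^sub>R y" by (simp add: a_def z_def)
  then show ?thesis using that[of y \<mu>] yy bound by (simp add: norm_eq_1)
qed

text \<open>Induction on the dimension: the Rayleigh maximiser \<open>y\<close> is split off, and
  symmetry keeps the part of \<open>W\<close> orthogonal to \<open>y\<close> invariant. Working with
  sets postpones the choice of an indexing.\<close>

lemma orthonormal_eigenbasis_set:
  fixes M :: "real^'n^'n"
  assumes M: "transpose M = M" and "subspace W" "\<And>x. x \<in> W \<Longrightarrow> M *v x \<in> W"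
  shows "\<exists>B. pairwise orthogonal B \<and> span B = W \<and> (\<forall>x\<in>B. norm x = 1 \<and> (\<exists>\<mu>. M *v x = \<mu> *\<^sub>R x))"
  using assms(2,3)
proof (induction "dim W" arbitrary: W rule: less_induct)
  case less
  show ?case
  proof (cases "W = {0}")
    case True
    then show ?thesis by (intro exI[of _ "{}"]) auto
  next
    case False
    obtain y \<mu> where y: "y \<in> W" "norm y = 1" "M *v y = \<mu> *\<^sub>R y"
      using rayleigh_max[OF M less.prems(1) False less.prems(2)] by blast
    define W' where "W' = W \<inter> {v. y \<bullet> v = 0}"
    have sub: "subspace W'" unfolding W'_def
      using less.prems(1) by (intro subspace_inter subspace_hyperplane)
    have yn: "y \<notin> W'" using y by (auto simp: W'_def)
    have yy: "y \<bullet> y = 1" using y by (simp add: norm_eq_1)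
    have "W' \<subset> W" using yn y unfolding W'_def by blast
    then have "dim W' < dim W"
      using sub less.prems(1) by (intro dim_psubset) (metis span_eq_iff)
    moreover have "M *v x \<in> W'" if "x \<in> W'" for x
      using that less.prems(2) y symmetric_dot[OF M, of y x] by (auto simp: W'_def)
    ultimately obtain B where B: "pairwise orthogonal B" "span B = W'"
      "\<forall>x\<in>B. norm x = 1 \<and> (\<exists>\<mu>. M *v x = \<mu> *\<^sub>R x)"
      using less.hyps[OF _ sub] by blast
    have BW: "B \<subseteq> W'" using B(2) span_superset by blast
    have "span (insert y B) = W"
    proof
      show "span (insert y B) \<subseteq> W"
        using BW y less.prems(1) by (intro span_minimal) (auto simp: W'_def)
      show "W \<subseteq> span (insert y B)"
      proof
        fix w assume w: "w \<in> W"
        have "w - (y \<bullet> w) *\<^sub>R y \<in> W'"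
          using w y yy less.prems(1) by (auto simp: W'_def inner_diff_right subspace_diff subspace_scale)
        then show "w \<in> span (insert y B)"
          using B(2) span_breakdown_eq by blast
      qed
    qed
    moreover have "pairwise orthogonal (insert y B)"
      using B(1) BW by (auto simp: pairwise_insert orthogonal_def W'_def inner_commute)
    ultimately show ?thesis using B y by (intro exI[of _ "insert y B"]) auto
  qed
qed

lemma orthonormal_eigenbasis:
  fixes M :: "real^'n^'n" and I :: "'i set"
  assumes M: "transpose M = M" and W: "subspace W" "\<And>x. x \<in> W \<Longrightarrow> M *v x \<in> W"
    and I: "finite I" "card I = dim W"
  obtains x d where "orthonormal_on I x" "span (x ` I) = W" "\<And>i. i \<in> I \<Longrightarrow> M *v x i = d i *\<^sub>R x i"
proof -
  obtain B where B: "pairwise orthogonal B" "span B = W"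
      "\<forall>x\<in>B. norm x = 1 \<and> (\<exists>\<mu>. M *v x = \<mu> *\<^sub>R x)"
    using orthonormal_eigenbasis_set[OF M W] by blast
  have indep: "independent B"
    using B by (intro pairwise_orthogonal_independent) auto
  then have "finite B" "card B = dim W"
    using B(2) dim_span_eq_card_independent[OF indep] by (simp_all add: independent_imp_finite)
  then obtain x where x: "bij_betw x I B"
    using I by (metis finite_same_card_bij)
  obtain \<mu> where \<mu>: "\<And>v. v \<in> B \<Longrightarrow> M *v v = \<mu> v *\<^sub>R v" using B(3) by metis
  have "orthonormal_on I x"
    unfolding orthonormal_on_def
  proof (intro ballI)
    fix i j assume ij: "i \<in> I" "j \<in> I"
    then have "x i \<in> B" "x j \<in> B" "x i = x j \<longleftrightarrow> i = j"
      using x by (auto simp: bij_betw_def inj_on_def)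
    then show "x i \<bullet> x j = (if i = j then 1 else 0)"
      using B by (auto simp: pairwise_def orthogonal_def norm_eq_1)
  qed
  moreover have "span (x ` I) = W" using x B by (simp add: bij_betw_def)
  moreover have "M *v x i = \<mu> (x i) *\<^sub>R x i" if "i \<in> I" for i
    using \<mu> x that by (auto simp: bij_betw_def)
  ultimately show ?thesis using that[of x "\<lambda>i. \<mu> (x i)"] by blast
qed

text \<open>The dimension count behind the Courant-Fischer principle: a nonzero vector common to
  \<open>S\<close> and \<open>T\<close> would have a form value both at least and below \<tau> times
  its squared length.\<close>

lemma form_separation_dim:
  fixes M :: "real^'n^'n"
  assumes "subspace S" "subspace T"
    and S: "\<And>v. v \<in> S \<Longrightarrow> v \<bullet> (M *v v) \<ge> \<tau> * (v \<bullet> v)"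
    and T: "\<And>v. v \<in> T \<Longrightarrow> v \<noteq> 0 \<Longrightarrow> v \<bullet> (M *v v) < \<tau> * (v \<bullet> v)"
  shows "dim S + dim T \<le> CARD('n)"
proof -
  have "S \<inter> T \<subseteq> {0}" using S T by fastforce
  then have "dim (S \<inter> T) = 0" by (simp add: dim_eq_0)
  moreover have "dim {x + y |x y. x \<in> S \<and> y \<in> T} \<le> CARD('n)"
    using dim_subset_UNIV[of "{x + y |x y. x \<in> S \<and> y \<in> T}"] by simp
  ultimately show ?thesis using dim_sums_Int[OF assms(1,2)] by linarith
qed

section \<open>Orthonormal systems: dimension, expansion and quadratic forms\<close>

lemma orthonormal_on_subset: "orthonormal_on I x \<Longrightarrow> J \<subseteq> I \<Longrightarrow> orthonormal_on J x"
  unfolding orthonormal_on_def by (meson subsetD)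

lemma orthonormal_on_inj: "orthonormal_on I x \<Longrightarrow> inj_on x I"
  unfolding orthonormal_on_def inj_on_def by (metis zero_neq_one)

lemma orthonormal_on_dim:
  fixes x :: "'i \<Rightarrow> 'a::euclidean_space"
  assumes "orthonormal_on I x" "finite I"
  shows "dim (span (x ` I)) = card I"
proof -
  have "independent (x ` I)"
    using assms(1) by (intro pairwise_orthogonal_independent)
      (auto simp: pairwise_def orthogonal_def orthonormal_on_def split: if_splits)
  then show ?thesis
    by (metis assms(1) card_image dim_span dim_eq_card_independent orthonormal_on_inj)
qed

lemma orthonormal_on_expand:
  fixes x :: "'i \<Rightarrow> 'a::euclidean_space"
  assumes "orthonormal_on I x" "finite I" "v \<in> span (x ` I)"
  shows "v = (\<Sum>i\<in>I. (v \<bullet> x i) *\<^sub>R x i)"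
proof -
  let ?s = "\<Sum>i\<in>I. (v \<bullet> x i) *\<^sub>R x i"
  have in_span: "v - ?s \<in> span (x ` I)"
    using assms(3) by (intro span_diff span_sum span_scale) (auto intro: span_base)
  have orth: "(v - ?s) \<bullet> x j = 0" if "j \<in> I" for j
  proof -
    have "?s \<bullet> x j = (\<Sum>i\<in>I. if i = j then v \<bullet> x j else 0)"
      unfolding inner_sum_left using assms(1) that
      by (intro sum.cong) (auto simp: orthonormal_on_def)
    then show ?thesis using assms(2) that by (simp add: inner_diff_left)
  qed
  have "orthogonal (v - ?s) w" if "w \<in> span (x ` I)" for w
    using that by (rule orthogonal_to_span) (use orth in \<open>auto simp: orthogonal_def\<close>)
  from this[OF in_span] show ?thesis by (simp add: orthogonal_def)
qed

text \<open>Only the compression of \<open>M\<close> to the span is assumed diagonal; the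
  \<open>x i\<close> need not be eigenvectors. In this generality the formulas serve an arbitrary
  competing frame after rotation.\<close>

lemma orthonormal_form:
  fixes M :: "real^'n^'n" and x :: "'i \<Rightarrow> real^'n"
  assumes "orthonormal_on I x" "finite I" "v \<in> span (x ` I)"
    and diag: "\<And>i j. i \<in> I \<Longrightarrow> j \<in> I \<Longrightarrow> x i \<bullet> (M *v x j) = (if i = j then b i else 0)"
  shows "v \<bullet> (M *v v) = (\<Sum>i\<in>I. b i * (v \<bullet> x i)\<^sup>2)" "v \<bullet> v = (\<Sum>i\<in>I. (v \<bullet> x i)\<^sup>2)"
proof -
  define c where "c i = v \<bullet> x i" for i
  have v: "v = (\<Sum>i\<in>I. c i *\<^sub>R x i)"
    unfolding c_def by (rule orthonormal_on_expand[OF assms(1-3)])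
  have "v \<bullet> (M *v v) = (\<Sum>i\<in>I. c i *\<^sub>R x i) \<bullet> (M *v (\<Sum>j\<in>I. c j *\<^sub>R x j))"
    using v by simp
  also have "\<dots> = (\<Sum>j\<in>I. \<Sum>i\<in>I. c i * c j * (x i \<bullet> (M *v x j)))"
    by (simp add: inner_sum_left inner_sum_right sum_distrib_left
        linear_sum[OF matrix_vector_mul_linear] matrix_vector_mult_scaleR mult_ac)
  also have "\<dots> = (\<Sum>i\<in>I. \<Sum>j\<in>I. c i * c j * (x i \<bullet> (M *v x j)))"
    by (rule sum.swap)
  also have "\<dots> = (\<Sum>i\<in>I. \<Sum>j\<in>I. if i = j then b i * (c i)\<^sup>2 else 0)"
    using diag by (intro sum.cong refl) (auto simp: power2_eq_square)
  finally show "v \<bullet> (M *v v) = (\<Sum>i\<in>I. b i * (v \<bullet> x i)\<^sup>2)"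
    using assms(2) by (simp add: c_def)
  have "v \<bullet> v = (\<Sum>i\<in>I. c i *\<^sub>R x i) \<bullet> v" using v by simp
  also have "\<dots> = (\<Sum>i\<in>I. (c i)\<^sup>2)"
    by (subst inner_sum_left) (simp add: c_def power2_eq_square inner_commute)
  finally show "v \<bullet> v = (\<Sum>i\<in>I. (v \<bullet> x i)\<^sup>2)" by (simp add: c_def)
qed

section \<open>Elementary symmetric polynomials of eigenvalues\<close>

text \<open>Unlike \<open>sym_eig\<close>, this takes any index set, so that removing an index gives
  the factors that occur in derivatives.\<close>

definition esym :: "nat \<Rightarrow> 'i set \<Rightarrow> ('i \<Rightarrow> real) \<Rightarrow> real" where
  "esym q S b = (\<Sum>I | I \<subseteq> S \<and> card I = q. \<Prod>i\<in>I. b i)"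

lemma esym_mono:
  assumes "finite S" "\<And>i. i \<in> S \<Longrightarrow> 0 \<le> b i" "\<And>i. i \<in> S \<Longrightarrow> b i \<le> c i"
  shows "esym q S b \<le> esym q S c"
  unfolding esym_def using assms by (intro sum_mono prod_mono) auto

lemma esym_nonneg:
  assumes "\<And>i. i \<in> S \<Longrightarrow> 0 \<le> b i"
  shows "0 \<le> esym q S b"
  unfolding esym_def using assms by (intro sum_nonneg prod_nonneg) auto

lemma esym_cong:
  assumes "\<And>i. i \<in> S \<Longrightarrow> b i = c i"
  shows "esym q S b = esym q S c"
  unfolding esym_def using assms by (intro sum.cong prod.cong) auto

lemma esym_reindex:
  assumes "bij_betw \<pi> S T"
  shows "esym q T b = esym q S (\<lambda>i. b (\<pi> i))"
proof -
  have inj: "inj_on \<pi> S" and im: "\<pi> ` S = T" using assms by (auto simp: bij_betw_def)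
  have "bij_betw ((`) \<pi>) {I. I \<subseteq> S \<and> card I = q} {J. J \<subseteq> T \<and> card J = q}"
  proof (rule bij_betw_imageI)
    show "inj_on ((`) \<pi>) {I. I \<subseteq> S \<and> card I = q}"
      using inj_on_image_Pow[OF inj] by (rule inj_on_subset) auto
    show "(`) \<pi> ` {I. I \<subseteq> S \<and> card I = q} = {J. J \<subseteq> T \<and> card J = q}"
    proof (intro set_eqI iffI)
      fix J assume "J \<in> {J. J \<subseteq> T \<and> card J = q}"
      then obtain I where "I \<subseteq> S" "J = \<pi> ` I" "card J = q" using im by (auto simp: subset_image_iff)
      then show "J \<in> (`) \<pi> ` {I. I \<subseteq> S \<and> card I = q}"
        using card_image[OF inj_on_subset[OF inj \<open>I \<subseteq> S\<close>]] by auto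
    next
      fix J assume "J \<in> (`) \<pi> ` {I. I \<subseteq> S \<and> card I = q}"
      then obtain I where "I \<subseteq> S" "card I = q" "J = \<pi> ` I" by blast
      then show "J \<in> {J. J \<subseteq> T \<and> card J = q}"
        using im card_image[OF inj_on_subset[OF inj \<open>I \<subseteq> S\<close>]] by auto
    qed
  qed
  then have "esym q T b = (\<Sum>I | I \<subseteq> S \<and> card I = q. \<Prod>j\<in>\<pi> ` I. b j)"
    unfolding esym_def by (rule sum.reindex_bij_betw[symmetric])
  also have "\<dots> = esym q S (\<lambda>i. b (\<pi> i))"
    unfolding esym_def using inj by (intro sum.cong refl) (simp add: prod.reindex inj_on_subset)
  finally show ?thesis .
qed

lemma esym_0 [simp]: "finite S \<Longrightarrow> esym 0 S b = 1"
proof -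
  assume "finite S"
  then have "{I. I \<subseteq> S \<and> card I = 0} = {{}}" by (auto dest: finite_subset)
  then show ?thesis by (simp add: esym_def)
qed

lemma esym_insert:
  assumes "finite S" "a \<notin> S"
  shows "esym (Suc q) (insert a S) b = esym (Suc q) S b + b a * esym q S b"
proof -
  let ?P = "\<lambda>q S. {I. I \<subseteq> S \<and> card I = q}"
  have fin: "finite (?P q S)" for q using assms(1) by simp
  have eq: "?P (Suc q) (insert a S) = ?P (Suc q) S \<union> insert a ` ?P q S"
  proof (intro set_eqI iffI)
    fix I assume I: "I \<in> ?P (Suc q) (insert a S)"
    show "I \<in> ?P (Suc q) S \<union> insert a ` ?P q S"
    proof (cases "a \<in> I")
      case True
      then have "I = insert a (I - {a})" "I - {a} \<in> ?P q S"
        using I assms(1) by (auto simp: card_Diff_singleton)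
      then show ?thesis by blast
    qed (use I in auto)
  next
    fix I assume "I \<in> ?P (Suc q) S \<union> insert a ` ?P q S"
    then show "I \<in> ?P (Suc q) (insert a S)"
      using assms by (auto simp: card_insert_if finite_subset subset_iff)
  qed
  have inj: "inj_on (insert a) (?P q S)"
    using assms(2) by (intro inj_onI) (metis (no_types, lifting) insert_ident mem_Collect_eq subsetD)
  have "esym (Suc q) (insert a S) b =
      (\<Sum>I\<in>?P (Suc q) S. \<Prod>i\<in>I. b i) + (\<Sum>I\<in>insert a ` ?P q S. \<Prod>i\<in>I. b i)"
    unfolding esym_def eq using fin assms(2) by (intro sum.union_disjoint) auto
  also have "(\<Sum>I\<in>insert a ` ?P q S. \<Prod>i\<in>I. b i) = (\<Sum>I\<in>?P q S. b a * (\<Prod>i\<in>I. b i))"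
    unfolding sum.reindex[OF inj] o_def using assms
    by (intro sum.cong refl prod.insert) (auto dest: finite_subset)
  finally show ?thesis by (simp add: esym_def sum_distrib_left)
qed

text \<open>The polynomial is affine in each single variable, with the leave-one-out polynomial of
  degree q - 1 as slope. The variational formulas below rest on this, since rotating one column
  towards a normal eigenvector changes a single entry.\<close>

lemma esym_update:
  fixes b :: "'i::finite \<Rightarrow> real"
  assumes "q \<ge> 1"
  shows "esym q UNIV (b(i := x)) = esym q (UNIV - {i}) b + x * esym (q - 1) (UNIV - {i}) b"
proof -
  have "esym (Suc (q - 1)) (insert i (UNIV - {i})) (b(i := x)) =
      esym (Suc (q - 1)) (UNIV - {i}) (b(i := x)) + x * esym (q - 1) (UNIV - {i}) (b(i := x))"
    by (subst esym_insert) auto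
  moreover have "insert i (UNIV - {i}) = UNIV" by auto
  moreover have "esym k (UNIV - {i}) (b(i := x)) = esym k (UNIV - {i}) b" for k
    by (rule esym_cong) auto
  ultimately show ?thesis using assms by simp
qed

text \<open>The summands that do not vanish are those whose index set consists of positive entries.
  For a Gram matrix the number of these entries will be a rank.\<close>

lemma esym_pos_iff:
  assumes "finite S" "\<And>i. i \<in> S \<Longrightarrow> 0 \<le> b i"
  shows "esym q S b > 0 \<longleftrightarrow> q \<le> card {i\<in>S. b i > 0}"
proof -
  have fin: "finite {I. I \<subseteq> S \<and> card I = q}" using assms(1) by simp
  have nn: "(\<Prod>i\<in>I. b i) \<ge> 0" if "I \<in> {I. I \<subseteq> S \<and> card I = q}" for I
    using that assms(2) by (auto intro!: prod_nonneg)
  have "esym q S b = 0 \<longleftrightarrow> (\<forall>I\<in>{I. I \<subseteq> S \<and> card I = q}. (\<Prod>i\<in>I. b i) = 0)"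
    unfolding esym_def using fin nn by (rule sum_nonneg_eq_0_iff)
  then have "esym q S b > 0 \<longleftrightarrow> (\<exists>I. I \<subseteq> S \<and> card I = q \<and> (\<Prod>i\<in>I. b i) \<noteq> 0)"
    using esym_nonneg[of S b q] assms(2) by (auto simp: less_le)
  also have "\<dots> \<longleftrightarrow> (\<exists>I. I \<subseteq> {i\<in>S. b i > 0} \<and> card I = q)"
  proof (intro ex_cong1 iffI conjI; elim conjE)
    fix I assume "I \<subseteq> S" "(\<Prod>i\<in>I. b i) \<noteq> 0"
    then show "I \<subseteq> {i\<in>S. b i > 0}"
      using assms by (auto simp: prod_zero_iff finite_subset less_le)
  next
    fix I assume "I \<subseteq> {i\<in>S. b i > 0}"
    then have "(\<Prod>i\<in>I. b i) > 0" by (intro prod_pos) auto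
    then show "(\<Prod>i\<in>I. b i) \<noteq> 0" by simp
  qed auto
  also have "\<dots> \<longleftrightarrow> q \<le> card {i\<in>S. b i > 0}"
  proof
    assume "\<exists>I. I \<subseteq> {i\<in>S. b i > 0} \<and> card I = q"
    then show "q \<le> card {i\<in>S. b i > 0}" using assms(1) by (auto intro!: card_mono)
  next
    assume "q \<le> card {i\<in>S. b i > 0}"
    then show "\<exists>I. I \<subseteq> {i\<in>S. b i > 0} \<and> card I = q"
      by (rule obtain_subset_with_card_n) blast
  qed
  finally show ?thesis .
qed

section \<open>Elementary symmetric polynomials as coefficients, recovered from values\<close>

lemma coeff_prod_esym:
  "finite S \<Longrightarrow> poly.coeff (\<Prod>i\<in>S. [:1, b i:]) q = esym q S b"
proof (induction S arbitrary: q rule: finite_induct)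
  case empty
  have "{I::'a set. I = {} \<and> card I = q} = (if q = 0 then {{}} else {})" by auto
  then show ?case by (auto simp: esym_def coeff_pCons split: nat.split)
next
  case (insert a S)
  show ?case
  proof (cases q)
    case 0
    then show ?thesis using insert by (simp add: insert.IH)
  next
    case (Suc r)
    then show ?thesis using insert by (simp add: esym_insert insert.IH)
  qed
qed

text \<open>Lagrange interpolation at the nodes 0, ..., n, with \<open>L k\<close> the basis
  polynomials. The point is the order of the quantifiers: the weights \<open>c\<close> serve all
  polynomials of degree at most \<open>n\<close> at once.\<close>

lemma coeff_interpolation:
  "\<exists>c::nat \<Rightarrow> real. \<forall>P. degree P \<le> n \<longrightarrow> poly.coeff P q = (\<Sum>k\<le>n. c k * poly P (real k))"
proof -
  define L :: "nat \<Rightarrow> real poly" where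
    "L k = (\<Prod>j\<in>{..n} - {k}. smult (1 / (real k - real j)) [:- real j, 1:])" for k
  have deg: "degree (L k) \<le> n" if "k \<le> n" for k
  proof -
    have "degree (L k) \<le> (\<Sum>j\<in>{..n} - {k}. degree (smult (1 / (real k - real j)) [:- real j, 1:]))"
      unfolding L_def by (rule degree_prod_sum_le[unfolded o_def]) auto
    also have "\<dots> \<le> (\<Sum>j\<in>{..n} - {k}. 1)"
      by (rule sum_mono) (use degree_smult_le le_trans in fastforce)
    finally show ?thesis using that by simp
  qed
  have val: "poly (L k) (real m) = (if k = m then 1 else 0)" if "k \<le> n" "m \<le> n" for k m
  proof (cases "k = m")
    case True
    then show ?thesis by (auto simp: L_def poly_prod diff_divide_distrib[symmetric] intro!: prod.neutral)
  next
    case False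
    then show ?thesis using that by (auto simp: L_def poly_prod prod_zero_iff)
  qed
  have "poly.coeff P q = (\<Sum>k\<le>n. poly.coeff (L k) q * poly P (real k))" if P: "degree P \<le> n" for P
  proof -
    have "P = (\<Sum>k\<le>n. smult (poly P (real k)) (L k))"
    proof (rule poly_eqI_degree[of "real ` {..n}"])
      fix x assume "x \<in> real ` {..n}"
      then obtain m where m: "x = real m" "m \<le> n" by auto
      have "poly (\<Sum>k\<le>n. smult (poly P (real k)) (L k)) x = (\<Sum>k\<le>n. if k = m then poly P (real m) else 0)"
        unfolding poly_sum by (rule sum.cong) (use m val in auto)
      then show "poly P x = poly (\<Sum>k\<le>n. smult (poly P (real k)) (L k)) x" using m by simp
    next
      have card: "card (real ` {..n}) = Suc n" by (subst card_image) (auto simp: inj_on_def)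
      show "degree P < card (real ` {..n})" using P card by simp
      have "degree (\<Sum>k\<le>n. smult (poly P (real k)) (L k)) \<le> n"
        by (rule degree_sum_le) (auto intro: order.trans[OF degree_smult_le] deg)
      then show "degree (\<Sum>k\<le>n. smult (poly P (real k)) (L k)) < card (real ` {..n})" using card by simp
    qed
    then have "poly.coeff P q = poly.coeff (\<Sum>k\<le>n. smult (poly P (real k)) (L k)) q" by simp
    then show ?thesis by (simp add: coeff_sum mult.commute)
  qed
  then show ?thesis by (intro exI[of _ "\<lambda>k. poly.coeff (L k) q"]) simp
qed

section \<open>Diagonal matrices, characteristic polynomials and orthogonal conjugation\<close>

definition diag_matrix :: "('k \<Rightarrow> real) \<Rightarrow> real^'k^'k" where
  "diag_matrix d = (\<chi> i j. if i = j then d i else 0)"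

lemma diag_matrix_nth: "diag_matrix d $ i $ j = (if i = j then d i else 0)"
  by (simp add: diag_matrix_def)

lemma transpose_diag_matrix [simp]: "transpose (diag_matrix d) = diag_matrix d"
  by (simp add: diag_matrix_def transpose_def vec_eq_iff)

lemma det_diag_matrix: "det (diag_matrix d) = (\<Prod>i\<in>UNIV. d i)"
  by (subst det_diagonal) (auto simp: diag_matrix_def)

lemma poly_char_polynomial: "poly (char_polynomial B) t = det (mat t - B)"
proof -
  have "poly (map_matrix (\<lambda>c. [:c:]) B $ i $ j) t = B $ i $ j" for i j by simp
  have "poly ((mat [:0, 1:] - map_matrix (\<lambda>c. [:c:]) B) $ i $ j) t = (mat t - B) $ i $ j" for i j
    by (simp add: mat_def)
  then show ?thesis
    by (simp add: char_polynomial_def det_def poly_sum poly_prod del: vector_minus_component)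
qed

lemma orthogonal_matrix_eqs:
  "orthogonal_matrix U \<Longrightarrow> transpose U ** U = mat 1" "orthogonal_matrix U \<Longrightarrow> U ** transpose U = mat 1"
  by (simp_all add: orthogonal_matrix_def)

lemma det_orthogonal_conj:
  fixes U :: "real^'k^'k"
  assumes "orthogonal_matrix U"
  shows "det (transpose U ** B ** U) = det B"
proof -
  have "det (transpose U) * det U = 1"
    using orthogonal_matrix_eqs(1)[OF assms] by (metis det_I det_mul)
  then show ?thesis by (simp add: det_mul mult.commute mult.left_commute)
qed

lemma matrix_mult_add_rdistrib:
  fixes A B :: "real^'k^'m"
  shows "(A + B) ** C = A ** C + B ** C"
  by (simp add: matrix_matrix_mult_def vec_eq_iff distrib_right sum.distrib)

lemma orthogonal_conj_affine:
  fixes U :: "real^'k^'k"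
  assumes "orthogonal_matrix U"
  shows "transpose U ** (s *\<^sub>R mat 1 + t *\<^sub>R B) ** U = s *\<^sub>R mat 1 + t *\<^sub>R (transpose U ** B ** U)"
  using orthogonal_matrix_eqs(1)[OF assms]
  by (simp add: matrix_add_ldistrib matrix_mult_add_rdistrib matrix_scalar_ac flip: scalar_matrix_assoc)

lemma char_polynomial_orthogonal_conj:
  fixes U :: "real^'k^'k"
  assumes "orthogonal_matrix U"
  shows "char_polynomial (transpose U ** B ** U) = char_polynomial B"
proof -
  have "det (mat t - transpose U ** B ** U) = det (mat t - B)" for t
  proof -
    have "mat t - C = t *\<^sub>R mat 1 + (- 1) *\<^sub>R C" for C :: "real^'k^'k"
      by (simp add: mat_def vec_eq_iff)
    then have "mat t - transpose U ** B ** U = transpose U ** (mat t - B) ** U"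
      using orthogonal_conj_affine[OF assms, of t "- 1" B] by metis
    then show ?thesis using det_orthogonal_conj[OF assms] by simp
  qed
  then show ?thesis
    by (subst poly_eq_poly_eq_iff[symmetric]) (simp add: poly_char_polynomial fun_eq_iff)
qed

lemma sym_eig_orthogonal_conj:
  fixes U :: "real^'k^'k"
  assumes "orthogonal_matrix U"
  shows "sym_eig q (transpose U ** B ** U) = sym_eig q B"
  using char_polynomial_orthogonal_conj[OF assms] by (simp add: sym_eig_def eigenvalue_list_def)

lemma eigenvalue_list_orthogonal_conj:
  fixes U :: "real^'k^'k"
  assumes "orthogonal_matrix U"
  shows "eigenvalue_list (transpose U ** B ** U) = eigenvalue_list B"
  using char_polynomial_orthogonal_conj[OF assms] by (simp add: eigenvalue_list_def)

lemma mset_eigenvalue_list_diag: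
  "mset (eigenvalue_list (diag_matrix d)) = image_mset d (mset_set UNIV)"
proof -
  have "mat t - diag_matrix d = diag_matrix (\<lambda>i. t - d i)" for t
    by (simp add: mat_def diag_matrix_def vec_eq_iff)
  then have "char_polynomial (diag_matrix d) = (\<Prod>i\<in>UNIV. [:- d i, 1:])"
    by (subst poly_eq_poly_eq_iff[symmetric])
      (simp add: poly_char_polynomial fun_eq_iff det_diag_matrix poly_prod)
  then have "proots (char_polynomial (diag_matrix d)) = image_mset d (mset_set UNIV)"
    by (simp add: proots_prod sum_unfold_sum_mset)
  then show ?thesis by (simp add: eigenvalue_list_def)
qed

text \<open>Equal multisets differ by a permutation; composed with an enumeration of
  \<open>I\<close> it matches positions and indices bijectively even if values of \<open>d\<close>
  repeat.\<close>

lemma mset_enumeration: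
  assumes "finite I" "mset xs = image_mset d (mset_set I)"
  obtains f where "bij_betw f {..<length xs} I" "\<And>k. k < length xs \<Longrightarrow> xs ! k = d (f k)"
proof -
  obtain ys where ys: "set ys = I" "distinct ys" using assms(1) finite_distinct_list by blast
  then have "mset xs = mset (map d ys)" using assms(2) by (auto simp: mset_set_set)
  then obtain p where p: "p permutes {..<length (map d ys)}" "permute_list p (map d ys) = xs"
    by (rule mset_eq_permutation)
  have len: "length xs = length ys" using p(2) by auto
  have "bij_betw (\<lambda>k. ys ! p k) {..<length xs} I"
    using bij_betw_trans[OF permutes_imp_bij[OF p(1)] bij_betw_nth[OF ys(2), of "{..<length (map d ys)}" I]]
    using ys len by (simp add: o_def)
  moreover have "xs ! k = d (ys ! p k)" if "k < length xs" for k
    using that len p permutes_in_image[OF p(1), of k]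
    by (metis (no_types, lifting) length_map lessThan_iff nth_map permute_list_nth)
  ultimately show ?thesis using that by blast
qed

lemma sym_eig_diag:
  fixes d :: "'k::finite \<Rightarrow> real"
  shows "sym_eig q (diag_matrix d) = esym q UNIV d"
proof -
  let ?l = "eigenvalue_list (diag_matrix d)"
  obtain f where f: "bij_betw f {..<length ?l} (UNIV :: 'k set)" "\<And>k. k < length ?l \<Longrightarrow> ?l ! k = d (f k)"
    using mset_enumeration[OF _ mset_eigenvalue_list_diag[of d]] by auto
  have len: "length ?l = CARD('k)" using bij_betw_same_card[OF f(1)] by simp
  have "sym_eig q (diag_matrix d) = esym q {..<CARD('k)} (\<lambda>k. ?l ! k)"
    by (simp add: sym_eig_def esym_def)
  also have "\<dots> = esym q {..<CARD('k)} (\<lambda>k. d (f k))"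
    using f(2) len by (intro esym_cong) auto
  also have "\<dots> = esym q UNIV d"
    using esym_reindex[of f "{..<CARD('k)}" UNIV q d] f(1) len by simp
  finally show ?thesis .
qed

lemma transpose_mult_nth:
  fixes A :: "real^'k^'n" and B :: "real^'l^'n"
  shows "(transpose A ** B) $ i $ j = column i A \<bullet> column j B"
  by (simp add: matrix_matrix_mult_def transpose_def column_def inner_vec_def)

lemma column_mult:
  fixes A :: "real^'n^'m" and B :: "real^'l^'n"
  shows "column j (A ** B) = A *v column j B"
  by (simp add: matrix_matrix_mult_def matrix_vector_mult_def column_def vec_eq_iff)

lemma symmetric_diagonalise:
  fixes B :: "real^'k^'k"
  assumes "transpose B = B"
  obtains U d where "orthogonal_matrix U" "transpose U ** B ** U = diag_matrix d"
proof -
  obtain u d where u: "orthonormal_on (UNIV :: 'k set) u" "\<And>i. B *v u i = d i *\<^sub>R u i"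
    by (rule orthonormal_eigenbasis[OF assms subspace_UNIV, of "UNIV :: 'k set"]) auto
  define U where "U = (\<chi> a i. u i $ a)"
  have col: "column i U = u i" for i by (simp add: U_def column_def)
  have "transpose U ** U = mat 1"
    using u(1) by (simp add: vec_eq_iff transpose_mult_nth col mat_def orthonormal_on_def)
  then have "orthogonal_matrix U" by (simp add: orthogonal_matrix)
  moreover have "transpose U ** B ** U = diag_matrix d"
  proof -
    have "(transpose U ** (B ** U)) $ i $ j = u i \<bullet> (B *v u j)" for i j
      by (simp add: transpose_mult_nth column_mult col)
    then show ?thesis
      using u by (simp add: vec_eq_iff matrix_mul_assoc orthonormal_on_def diag_matrix_nth)
  qed
  ultimately show ?thesis using that by blast
qed

text \<open>After diagonalisation det(1 + t B) is the product of the factors 1 + t d_i, whose q-th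
  coefficient is the elementary symmetric polynomial; interpolation reads it off from the values at
  integers. The weights do not depend on \<open>B\<close>, so the formula can be differentiated
  along a curve of symmetric matrices.\<close>

lemma sym_eig_det:
  "\<exists>c. \<forall>B::real^'k^'k. transpose B = B \<longrightarrow> sym_eig q B = (\<Sum>k\<le>CARD('k). c k * det (mat 1 + real k *\<^sub>R B))"
proof -
  obtain c :: "nat \<Rightarrow> real"
    where c: "\<And>P. degree P \<le> CARD('k) \<Longrightarrow> poly.coeff P q = (\<Sum>k\<le>CARD('k). c k * poly P (real k))"
    using coeff_interpolation by blast
  have "sym_eig q B = (\<Sum>k\<le>CARD('k). c k * det (mat 1 + real k *\<^sub>R B))"
    if "transpose B = B" for B :: "real^'k^'k"
  proof -
    obtain U d where U: "orthogonal_matrix U" "transpose U ** B ** U = diag_matrix d"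
      using symmetric_diagonalise \<open>transpose B = B\<close> by blast
    let ?P = "\<Prod>i\<in>(UNIV :: 'k set). [:1, d i:]"
    have "degree ?P \<le> (\<Sum>i\<in>(UNIV :: 'k set). degree [:1, d i:])"
      by (rule degree_prod_sum_le[unfolded o_def]) auto
    also have "\<dots> \<le> (\<Sum>i\<in>(UNIV :: 'k set). 1)" by (rule sum_mono) auto
    finally have deg: "degree ?P \<le> CARD('k)" by simp
    have "poly ?P t = det (mat 1 + t *\<^sub>R B)" for t
    proof -
      have "transpose U ** (mat 1 + t *\<^sub>R B) ** U = diag_matrix (\<lambda>i. 1 + t * d i)"
      proof -
        have "transpose U ** (mat 1 + t *\<^sub>R B) ** U = mat 1 + t *\<^sub>R (transpose U ** B ** U)"
          using orthogonal_conj_affine[OF U(1), of 1 t B] by simp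
        also have "\<dots> = diag_matrix (\<lambda>i. 1 + t * d i)"
          unfolding U(2) by (simp add: vec_eq_iff diag_matrix_nth mat_def)
        finally show ?thesis .
      qed
      then have "det (mat 1 + t *\<^sub>R B) = (\<Prod>i\<in>UNIV. 1 + t * d i)"
        by (metis det_diag_matrix det_orthogonal_conj[OF U(1)])
      then show ?thesis by (simp add: poly_prod)
    qed
    moreover have "sym_eig q B = poly.coeff ?P q"
      using sym_eig_orthogonal_conj[OF U(1), of q B] by (simp add: U(2) sym_eig_diag coeff_prod_esym)
    ultimately show ?thesis using c[OF deg] by simp
  qed
  then show ?thesis by (intro exI[of _ c]) simp
qed

text \<open>A permutation other than the identity moves at least two indices. The product rule
  removes one factor, so at a diagonal matrix each remaining product still contains a vanishing
  off-diagonal entry.\<close>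

lemma det_has_derivative_at_diagonal:
  fixes K :: "real \<Rightarrow> real^'k^'k"
  assumes K': "\<And>i j. ((\<lambda>t. K t $ i $ j) has_real_derivative K' i j) (at 0)"
    and diag: "\<And>i j. i \<noteq> j \<Longrightarrow> K 0 $ i $ j = 0"
  shows "((\<lambda>t. det (K t)) has_real_derivative
    (\<Sum>i\<in>UNIV. K' i i * (\<Prod>j\<in>UNIV - {i}. K 0 $ j $ j))) (at 0)"
proof -
  let ?D = "\<lambda>p. \<Sum>i\<in>UNIV. K' i (p i) * (\<Prod>j\<in>UNIV - {i}. K 0 $ j $ p j)"
  have "((\<lambda>t. \<Prod>i\<in>UNIV. K t $ i $ p i) has_real_derivative ?D p) (at 0)" for p :: "'k \<Rightarrow> 'k"
    by (rule has_field_derivative_prod) (rule K')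
  then have "((\<lambda>t. det (K t)) has_real_derivative
      (\<Sum>p | p permutes (UNIV :: 'k set). of_int (sign p) * ?D p)) (at 0)"
    unfolding det_def by (intro DERIV_sum DERIV_cmult)
  moreover have "(\<Sum>p | p permutes (UNIV :: 'k set). of_int (sign p) * ?D p) = ?D id"
  proof -
    have "of_int (sign p) * ?D p = (if p = id then ?D id else 0)" if "p permutes (UNIV :: 'k set)" for p
    proof (cases "p = id")
      case False
      \<comment> \<open>If \<open>a\<close> is moved then so is \<open>p a\<close>, by injectivity,
        and at least one of the two differs from \<open>i\<close>.\<close>
      have "\<exists>j. j \<noteq> i \<and> p j \<noteq> j" for i
      proof -
        obtain a where a: "p a \<noteq> a" using False by (auto simp: fun_eq_iff)
        then have "p (p a) \<noteq> p a" using permutes_inj[OF that] by (metis injD)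
        then show ?thesis using a by metis
      qed
      then have "(\<Prod>j\<in>UNIV - {i}. K 0 $ j $ p j) = 0" for i
      proof -
        assume "\<And>i. \<exists>j. j \<noteq> i \<and> p j \<noteq> j"
        then obtain j where "j \<in> UNIV - {i}" "p j \<noteq> j" by blast
        then show ?thesis using diag[of j "p j"] by (intro prod_zero) auto
      qed
      then have "?D p = 0" by (simp only: mult_zero_right sum.neutral_const)
      then show ?thesis using False by simp
    qed simp
    then have "(\<Sum>p | p permutes (UNIV :: 'k set). of_int (sign p) * ?D p) =
        (\<Sum>p | p permutes (UNIV :: 'k set). if p = id then ?D id else 0)"
      by (intro sum.cong) auto
    then show ?thesis by (simp add: permutes_id finite_permutations)
  qed
  ultimately show ?thesis by simp
qed

text \<open>By the determinant formula the derivative depends on the velocity only through its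
  diagonal. Hence the curve may be exchanged for a diagonal one with the same diagonal velocity,
  along which \<open>esym_update\<close> gives the value at once.\<close>

lemma sym_eig_has_derivative_at_diagonal:
  fixes B :: "real \<Rightarrow> real^'k^'k"
  assumes "q \<ge> 1" and sym: "\<And>t. transpose (B t) = B t" and B0: "B 0 = diag_matrix d"
    and B': "\<And>j k. ((\<lambda>t. B t $ j $ k) has_real_derivative B' j k) (at 0)"
    and only: "\<And>j. j \<noteq> i \<Longrightarrow> B' j j = 0"
  shows "((\<lambda>t. sym_eig q (B t)) has_real_derivative B' i i * esym (q - 1) (UNIV - {i}) d) (at 0)"
proof -
  obtain c where c: "\<And>B::real^'k^'k. transpose B = B \<Longrightarrow>
      sym_eig q B = (\<Sum>k\<le>CARD('k). c k * det (mat 1 + real k *\<^sub>R B))"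
    using sym_eig_det by blast
  define D where "D k = (\<Sum>i\<in>UNIV. k * B' i i * (\<Prod>j\<in>UNIV - {i}. 1 + k * d j))" for k
  have *: "((\<lambda>t. sym_eig q (C t)) has_real_derivative (\<Sum>k\<le>CARD('k). c k * D k)) (at 0)"
    if C: "\<And>t. transpose (C t) = C t" "C 0 = diag_matrix d"
      "\<And>j k. ((\<lambda>t. C t $ j $ k) has_real_derivative C' j k) (at 0)" "\<And>j. C' j j = B' j j"
    for C :: "real \<Rightarrow> real^'k^'k" and C'
  proof -
    have "((\<lambda>t. det (mat 1 + real k *\<^sub>R C t)) has_real_derivative D k) (at 0)" for k
    proof -
      have "((\<lambda>t. (mat 1 + real k *\<^sub>R C t) $ i $ j) has_real_derivative real k * C' i j) (at 0)" for i j
        using C(3)[of i j] by (auto intro!: derivative_eq_intros)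
      then have "((\<lambda>t. det (mat 1 + real k *\<^sub>R C t)) has_real_derivative
          (\<Sum>i\<in>UNIV. real k * C' i i * (\<Prod>j\<in>UNIV - {i}. (mat 1 + real k *\<^sub>R C 0) $ j $ j))) (at 0)"
        by (rule det_has_derivative_at_diagonal) (simp add: C(2) diag_matrix_nth mat_def)
      then show ?thesis by (simp add: D_def C(2,4) diag_matrix_nth mat_def)
    qed
    then show ?thesis unfolding c[OF C(1)] by (intro DERIV_sum DERIV_cmult)
  qed
  \<comment> \<open>The comparison curve, in which entry \<open>i\<close> alone moves. Computing its
    derivative in two ways evaluates the sum of the terms \<open>c k * D k\<close>.\<close>
  let ?C = "\<lambda>t. diag_matrix (d(i := d i + t * B' i i))"
  have "((\<lambda>t. sym_eig q (?C t)) has_real_derivative (\<Sum>k\<le>CARD('k). c k * D k)) (at 0)"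
  proof (rule *[where C' = "\<lambda>j k. if j = i \<and> k = i then B' i i else 0"])
    show "((\<lambda>t. ?C t $ j $ k) has_real_derivative (if j = i \<and> k = i then B' i i else 0)) (at 0)" for j k
    proof (cases "j = k \<and> j = i")
      case False
      then have "(\<lambda>t. ?C t $ j $ k) = (\<lambda>_. if j = k then d j else 0)" by (auto simp: diag_matrix_nth)
      then show ?thesis using False by auto
    qed (auto simp: diag_matrix_nth intro!: derivative_eq_intros)
  next
    show "transpose (?C t) = ?C t" for t by simp
    show "?C 0 = diag_matrix d" by (simp add: fun_upd_idem)
    show "(if j = i \<and> j = i then B' i i else 0) = B' j j" for j using only by auto
  qed
  moreover have "((\<lambda>t. sym_eig q (?C t)) has_real_derivative B' i i * esym (q - 1) (UNIV - {i}) d) (at 0)"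
    unfolding sym_eig_diag esym_update[OF assms(1)] by (auto intro!: derivative_eq_intros)
  ultimately have "(\<Sum>k\<le>CARD('k). c k * D k) = B' i i * esym (q - 1) (UNIV - {i}) d"
    by (rule DERIV_unique)
  then show ?thesis using *[OF sym B0 B'] by simp
qed

lemma sym_eig_mat1: "sym_eig q (mat 1 :: real^'k^'k) = real (CARD('k) choose q)"
proof -
  have "mat 1 = (diag_matrix (\<lambda>_. 1) :: real^'k^'k)" by (simp add: mat_def diag_matrix_def)
  then show ?thesis using n_subsets[of "UNIV :: 'k set" q] by (simp add: sym_eig_diag esym_def)
qed

section \<open>Dominant subspaces\<close>

text \<open>Greedy matching: a largest \<open>c\<close> is paired with a largest \<open>b\<close>,
  and the counting condition survives their removal.\<close>

lemma domination_bijection: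
  fixes b :: "'i \<Rightarrow> real" and c :: "'j \<Rightarrow> real"
  assumes "finite I" "finite J" "card I = card J"
    and count: "\<And>t. card {j\<in>J. t \<le> c j} \<le> card {i\<in>I. t \<le> b i}"
  shows "\<exists>\<pi>. bij_betw \<pi> J I \<and> (\<forall>j\<in>J. c j \<le> b (\<pi> j))"
  using assms
proof (induction "card J" arbitrary: I J)
  case 0
  then show ?case by (auto simp: bij_betw_def)
next
  case (Suc n)
  have "J \<noteq> {}" "I \<noteq> {}" using Suc.hyps(2) Suc.prems by auto
  obtain j0 where j0: "j0 \<in> J" "\<And>j. j \<in> J \<Longrightarrow> c j \<le> c j0"
    using Suc.prems(2) \<open>J \<noteq> {}\<close> Max_in[of "c ` J"] Max_ge[of "c ` J"]
    by (metis (no_types, lifting) finite_imageI image_iff image_is_empty image_eqI)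
  obtain i0 where i0: "i0 \<in> I" "\<And>i. i \<in> I \<Longrightarrow> b i \<le> b i0"
    using Suc.prems(1) \<open>I \<noteq> {}\<close> Max_in[of "b ` I"] Max_ge[of "b ` I"]
    by (metis (no_types, lifting) finite_imageI image_iff image_is_empty image_eqI)
  have top: "c j0 \<le> b i0"
  proof -
    have "card {j\<in>J. c j0 \<le> c j} \<noteq> 0" using j0 Suc.prems(2) by auto
    then have "card {i\<in>I. c j0 \<le> b i} \<noteq> 0" using Suc.prems(4)[of "c j0"] by linarith
    then obtain i where "i \<in> I" "c j0 \<le> b i" by (auto simp: card_eq_0_iff)
    then show ?thesis using i0 by force
  qed
  have "\<exists>\<pi>. bij_betw \<pi> (J - {j0}) (I - {i0}) \<and> (\<forall>j\<in>J - {j0}. c j \<le> b (\<pi> j))"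
  proof (rule Suc.hyps(1))
    show "n = card (J - {j0})" "finite (I - {i0})" "finite (J - {j0})" "card (I - {i0}) = card (J - {j0})"
      using Suc.hyps(2) Suc.prems i0 j0 by (auto simp: card_Diff_singleton)
    fix t
    show "card {j\<in>J - {j0}. t \<le> c j} \<le> card {i\<in>I - {i0}. t \<le> b i}"
    \<comment> \<open>For thresholds up to \<open>c j0\<close> both sets lose exactly one element;
      beyond it the left set is empty by maximality.\<close>
    proof (cases "t \<le> c j0")
      case True
      have "{j\<in>J - {j0}. t \<le> c j} = {j\<in>J. t \<le> c j} - {j0}" "{i\<in>I - {i0}. t \<le> b i} = {i\<in>I. t \<le> b i} - {i0}"
        by auto
      moreover have "j0 \<in> {j\<in>J. t \<le> c j}" "i0 \<in> {i\<in>I. t \<le> b i}" using True top i0 j0 by auto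
      ultimately show ?thesis using Suc.prems(4)[of t] by (simp add: card_Diff_singleton diff_le_mono)
    next
      case False
      then have "{j\<in>J - {j0}. t \<le> c j} = {}" using j0 by force
      then show ?thesis by (metis card.empty le0)
    qed
  qed
  then obtain \<pi> where \<pi>: "bij_betw \<pi> (J - {j0}) (I - {i0})" "\<And>j. j \<in> J - {j0} \<Longrightarrow> c j \<le> b (\<pi> j)"
    by blast
  have "bij_betw (\<pi>(j0 := i0)) (J - {j0}) (I - {i0})"
    using \<pi>(1) by (subst bij_betw_cong[of _ _ \<pi>]) auto
  then have "bij_betw (\<pi>(j0 := i0)) (insert j0 (J - {j0})) (insert i0 (I - {i0}))"
    using bij_betw_combine[of "\<pi>(j0 := i0)" "J - {j0}" "I - {i0}" "{j0}" "{i0}"]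
    by (auto simp: bij_betw_def)
  then have "bij_betw (\<pi>(j0 := i0)) J I" using i0 j0 by (simp add: insert_absorb)
  moreover have "c j \<le> b ((\<pi>(j0 := i0)) j)" if "j \<in> J" for j using that \<pi>(2) top by simp
  ultimately show ?case by blast
qed

text \<open>A dominant subspace is one spanned by leading eigenvectors of \<open>M\<close>.  Applied to \<open>- M\<close>, it is
  one spanned by trailing eigenvectors.\<close>

definition dominant_subspace :: "real^'n^'n \<Rightarrow> (real^'n) set \<Rightarrow> bool" where
  "dominant_subspace M S \<longleftrightarrow> subspace S \<and> (\<forall>v\<in>S. M *v v \<in> S) \<and>
     (\<exists>\<tau>. (\<forall>v\<in>S. \<tau> * (v \<bullet> v) \<le> v \<bullet> (M *v v)) \<and>
          (\<forall>v\<in>orthogonal_comp S. v \<bullet> (M *v v) \<le> \<tau> * (v \<bullet> v)))"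

lemma orthonormal_form_lower:
  fixes M :: "real^'n^'n"
  assumes x: "orthonormal_on I x" "finite I" and v: "v \<in> span (x ` I)"
    and diag: "\<And>i j. i \<in> I \<Longrightarrow> j \<in> I \<Longrightarrow> x i \<bullet> (M *v x j) = (if i = j then b i else 0)"
    and t: "\<And>i. i \<in> I \<Longrightarrow> t \<le> b i"
  shows "t * (v \<bullet> v) \<le> v \<bullet> (M *v v)"
proof -
  have form: "v \<bullet> (M *v v) = (\<Sum>i\<in>I. b i * (v \<bullet> x i)\<^sup>2)" "v \<bullet> v = (\<Sum>i\<in>I. (v \<bullet> x i)\<^sup>2)"
    using orthonormal_form[OF x v, of M b] diag by blast+
  show ?thesis
    unfolding form sum_distrib_left using t by (intro sum_mono mult_right_mono) auto
qed

text \<open>The span of the \<open>y j\<close> with \<open>c j\<close> at least \<open>t\<close> has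
  form at least \<open>t\<close>, while the orthogonal complement of the \<open>x i\<close> with
  \<open>b i\<close> at least \<open>t\<close> has form below \<open>t\<close>, so the dimensions
  bound one count by the other. The index types are free because the lemma is applied to frames as
  well as to a complete eigensystem.\<close>

lemma dominant_subspace_count:
  fixes M :: "real^'n^'n" and x :: "'i \<Rightarrow> real^'n" and y :: "'j \<Rightarrow> real^'n"
  assumes M: "transpose M = M" and dom: "dominant_subspace M S"
    and x: "orthonormal_on I x" "finite I" "span (x ` I) = S"
    and xM: "\<And>i j. i \<in> I \<Longrightarrow> j \<in> I \<Longrightarrow> x i \<bullet> (M *v x j) = (if i = j then b i else 0)"
    and y: "orthonormal_on J y" "finite J" "card J \<le> card I"
    and yM: "\<And>i j. i \<in> J \<Longrightarrow> j \<in> J \<Longrightarrow> y i \<bullet> (M *v y j) = (if i = j then c i else 0)"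
  shows "card {j\<in>J. t \<le> c j} \<le> card {i\<in>I. t \<le> b i}"
proof (cases "\<forall>i\<in>I. t \<le> b i")
  case True
  then have "{i\<in>I. t \<le> b i} = I" by auto
  moreover have "card {j\<in>J. t \<le> c j} \<le> card J" using y(2) by (intro card_mono) auto
  ultimately show ?thesis using y(3) by simp
next
  case False
  then obtain i1 where i1: "i1 \<in> I" "b i1 < t" by auto
  obtain \<tau> where S: "subspace S" and inv: "\<And>v. v \<in> S \<Longrightarrow> M *v v \<in> S"
    and low: "\<And>v. v \<in> S \<Longrightarrow> \<tau> * (v \<bullet> v) \<le> v \<bullet> (M *v v)"
    and up: "\<And>v. v \<in> orthogonal_comp S \<Longrightarrow> v \<bullet> (M *v v) \<le> \<tau> * (v \<bullet> v)"
    using dom unfolding dominant_subspace_def by blast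
  have "x i1 \<in> S" using i1(1) span_base[of "x i1" "x ` I"] unfolding x(3) by blast
  \<comment> \<open>\<open>b i1\<close> is the form value at a unit vector of \<open>S\<close>, so
    the separating threshold also lies below \<open>t\<close>. This is why the case that all
    \<open>b i\<close> reach \<open>t\<close> is treated apart.\<close>
  from low[OF this] have \<tau>: "\<tau> < t" using i1 x(1) xM by (simp add: orthonormal_on_def)
  let ?I = "{i\<in>I. t \<le> b i}" and ?J = "{j\<in>J. t \<le> c j}"
  let ?P = "span (y ` ?J)" and ?Q = "span (x ` ?I)"
  define T where "T = {v \<in> UNIV. \<forall>u\<in>?Q. orthogonal u v}"
  have dimT: "dim T + card ?I = CARD('n)"
    using dim_subspace_orthogonal_to_vectors[of ?Q UNIV] orthonormal_on_dim[of ?I x]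
      orthonormal_on_subset[OF x(1), of ?I] x(2) by (simp add: T_def)
  have "dim ?P + dim T \<le> CARD('n)"
  proof (rule form_separation_dim)
    show "subspace T" unfolding T_def by (auto simp: subspace_def orthogonal_def inner_add_right)
    show "t * (v \<bullet> v) \<le> v \<bullet> (M *v v)" if "v \<in> ?P" for v
      by (rule orthonormal_form_lower[OF orthonormal_on_subset[OF y(1)] _ that]) (use y yM in auto)
    fix v assume v: "v \<in> T" "v \<noteq> 0"
    obtain s w where s: "s \<in> S" and w: "w \<in> orthogonal_comp S" and vsw: "v = s + w"
    proof -
      obtain s w where "s \<in> span S" "\<And>u. u \<in> span S \<Longrightarrow> orthogonal w u" "v = s + w"
        using orthogonal_subspace_decomp_exists[of S v] by blast
      then show ?thesis
        using S that[of s w] by (simp add: orthogonal_comp_def orthogonal_commute span_eq_iff[THEN iffD2])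
    qed
    have ws: "w \<bullet> u = 0" if "u \<in> S" for u
      using w that by (simp add: orthogonal_comp_def orthogonal_def inner_commute)
    have vv: "v \<bullet> v = s \<bullet> s + w \<bullet> w"
      using ws[OF s] by (simp add: vsw inner_add_left inner_add_right inner_commute)
    have vMv: "v \<bullet> (M *v v) = s \<bullet> (M *v s) + w \<bullet> (M *v w)"
      using form_diff_expand[OF M, of s 1 w] ws[OF inv[OF s]] by (simp add: vsw)
    have sx: "s \<bullet> x i = 0" if "i \<in> ?I" for i
    proof -
      have "v \<bullet> x i = 0" using v(1) that span_base[of "x i" "x ` ?I"]
        by (auto simp: T_def orthogonal_def inner_commute)
      moreover have "w \<bullet> x i = 0" using ws that x(3) span_base[of "x i" "x ` I"] by auto
      ultimately show ?thesis by (simp add: vsw inner_add_left)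
    qed
    have s': "s \<in> span (x ` I)" using s x(3) by simp
    have sform: "s \<bullet> (M *v s) = (\<Sum>i\<in>I. b i * (s \<bullet> x i)\<^sup>2)" "s \<bullet> s = (\<Sum>i\<in>I. (s \<bullet> x i)\<^sup>2)"
      using orthonormal_form[OF x(1,2) s', of M b] xM by blast+
    have le: "b i * (s \<bullet> x i)\<^sup>2 \<le> t * (s \<bullet> x i)\<^sup>2" if "i \<in> I" for i
      using sx[of i] that by (cases "t \<le> b i") (auto intro: mult_right_mono)
    show "v \<bullet> (M *v v) < t * (v \<bullet> v)"
    \<comment> \<open>Strictness comes from a nonzero coefficient of \<open>s\<close> with
      \<open>b i\<close> below \<open>t\<close> if \<open>w\<close> is 0, and from the gap between
      \<tau> and \<open>t\<close> otherwise.\<close>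
    proof (cases "w = 0")
      case True
      then have "s \<noteq> 0" using v vsw by simp
      then have "(\<Sum>i\<in>I. (s \<bullet> x i)\<^sup>2) \<noteq> 0" using sform(2) by (metis inner_eq_zero_iff)
      then obtain i where i: "i \<in> I" "s \<bullet> x i \<noteq> 0" by (metis (mono_tags, lifting) sum.neutral zero_power2)
      then have "b i * (s \<bullet> x i)\<^sup>2 < t * (s \<bullet> x i)\<^sup>2"
        using sx[of i] by (intro mult_strict_right_mono) force+
      then have "(\<Sum>i\<in>I. b i * (s \<bullet> x i)\<^sup>2) < (\<Sum>i\<in>I. t * (s \<bullet> x i)\<^sup>2)"
        using i(1) le x(2) by (intro sum_strict_mono_ex1) auto
      then show ?thesis unfolding vMv vv sform using True by (simp add: sum_distrib_left)
    next
      case False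
      have "s \<bullet> (M *v s) \<le> t * (s \<bullet> s)"
        unfolding sform sum_distrib_left by (intro sum_mono le)
      moreover have "\<tau> * (w \<bullet> w) < t * (w \<bullet> w)"
        using False \<tau> by (intro mult_strict_right_mono) auto
      ultimately show ?thesis using up[OF w] unfolding vMv vv by (simp add: distrib_left)
    qed
  qed auto
  moreover have "dim ?P = card ?J"
    using orthonormal_on_dim[of ?J y] orthonormal_on_subset[OF y(1), of ?J] y(2) by simp
  ultimately show ?thesis using dimT by linarith
qed

lemma stiefel_iff: "X \<in> stiefel \<longleftrightarrow> orthonormal_on UNIV (\<lambda>i. column i X)"
  by (simp add: stiefel_def orthonormal_on_def vec_eq_iff transpose_mult_nth mat_def)

lemma compression_nth:
  fixes X :: "real^'p^'n"
  shows "(transpose X ** M ** X) $ i $ j = column i X \<bullet> (M *v column j X)"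
  by (simp add: matrix_mul_assoc[symmetric] transpose_mult_nth column_mult)

lemma col_range_eq: "col_range X = span (range (\<lambda>i. column i X))"
  by (simp add: col_range_def columns_def full_SetCompr_eq)

lemma dominant_bijection:
  fixes X Y :: "real^'p^'n"
  assumes "transpose M = M" "dominant_subspace M (col_range X)"
    and X: "X \<in> stiefel" "transpose X ** M ** X = diag_matrix b"
    and Y: "Y \<in> stiefel" "transpose Y ** M ** Y = diag_matrix c"
  obtains \<pi> where "bij \<pi>" "\<And>j. c j \<le> b (\<pi> j)"
proof -
  have "column i X \<bullet> (M *v column j X) = (if i = j then b i else 0)"
    "column i Y \<bullet> (M *v column j Y) = (if i = j then c i else 0)" for i j
    using X(2) Y(2) by (metis compression_nth diag_matrix_nth)+
  then have "card {j\<in>UNIV. t \<le> c j} \<le> card {i\<in>UNIV. t \<le> b i}" for t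
    using X(1) Y(1) unfolding stiefel_iff
    by (intro dominant_subspace_count[OF assms(1,2), where x = "\<lambda>i. column i X" and y = "\<lambda>i. column i Y"])
      (auto simp: col_range_eq)
  from domination_bijection[OF _ _ _ this] show ?thesis using that by auto
qed

section \<open>Invariance under rotation of the frame\<close>

definition gram :: "real^'n^'m \<Rightarrow> real^'n^'n" where
  "gram A = transpose A ** A"

lemma transpose_gram [simp]: "transpose (gram A) = gram A"
  by (simp add: gram_def matrix_transpose_mul)

lemma gram_form: "u \<bullet> (gram A *v v) = (A *v u) \<bullet> (A *v v)"
  by (metis gram_def dot_lmul_matrix matrix_vector_mul_assoc transpose_matrix_vector inner_commute)

lemma gram_form_nonneg: "0 \<le> v \<bullet> (gram A *v v)"
  by (simp add: gram_form)

lemma col_range_range: "col_range X = range (\<lambda>u. X *v u)"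
proof
  have "subspace (range (\<lambda>u. X *v u))"
    by (intro linear_subspace_image matrix_vector_mul_linear subspace_UNIV)
  moreover have "columns X \<subseteq> range (\<lambda>u. X *v u)"
    by (auto simp: columns_def simp flip: matrix_vector_mult_basis)
  ultimately show "col_range X \<subseteq> range (\<lambda>u. X *v u)"
    unfolding col_range_def by (intro span_minimal)
  show "range (\<lambda>u. X *v u) \<subseteq> col_range X"
    unfolding col_range_def using matrix_vector_mult_in_columnspace by blast
qed

lemma orthogonal_matrix_transpose_iff [simp]:
  "orthogonal_matrix (transpose U) \<longleftrightarrow> orthogonal_matrix (U :: real^'k^'k)"
  by (auto simp: orthogonal_matrix_def)

lemma rotate_back [simp]:
  fixes X :: "real^'p^'n"
  assumes "orthogonal_matrix U"
  shows "X ** U ** transpose U = X" "X ** transpose U ** U = X"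
  using orthogonal_matrix_eqs[OF assms] by (simp_all flip: matrix_mul_assoc)

lemma compression_rotate:
  fixes X :: "real^'p^'n" and U :: "real^'q^'p"
  shows "transpose (X ** U) ** M ** (X ** U) = transpose U ** (transpose X ** M ** X) ** U"
  by (simp add: matrix_transpose_mul matrix_mul_assoc)

lemma transpose_compression:
  fixes X :: "real^'p^'n"
  shows "transpose M = M \<Longrightarrow> transpose (transpose X ** M ** X) = transpose X ** M ** X"
  by (simp add: matrix_transpose_mul matrix_mul_assoc)

lemma stiefel_rotate:
  fixes X :: "real^'p^'n"
  assumes "X \<in> stiefel" "orthogonal_matrix U"
  shows "X ** U \<in> stiefel"
proof -
  have "transpose (X ** U) ** (X ** U) = transpose U ** (transpose X ** X) ** U"
    by (simp add: matrix_transpose_mul matrix_mul_assoc)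
  then show ?thesis
    using assms orthogonal_matrix_eqs[OF assms(2)] by (simp add: stiefel_def)
qed

lemma col_range_rotate:
  fixes X :: "real^'p^'n"
  assumes "orthogonal_matrix U"
  shows "col_range (X ** U) = col_range X"
proof -
  have "col_range (Y ** V) \<subseteq> col_range Y" for Y :: "real^'p^'n" and V :: "real^'p^'p"
    by (auto simp: col_range_range simp flip: matrix_vector_mul_assoc)
  from this[of X U] this[of "X ** U" "transpose U"] show ?thesis using assms by auto
qed

lemma stiefel_diagonalise:
  fixes X :: "real^'p^'n"
  assumes "X \<in> stiefel" "transpose M = M"
  obtains U b where "orthogonal_matrix U" "X ** U \<in> stiefel"
    "transpose (X ** U) ** M ** (X ** U) = diag_matrix b"
  using symmetric_diagonalise[OF transpose_compression[OF assms(2)], of X]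
    stiefel_rotate[OF assms(1)] by (metis compression_rotate)

lemma objective_eq:
  "objective A q X = sym_eig q (transpose X ** gram A ** X) / sym_eig q (transpose X ** X)"
  by (simp add: objective_def gram_def matrix_mul_assoc)

lemma objective_stiefel:
  fixes X :: "real^'p^'n"
  assumes "X \<in> stiefel"
  shows "objective A q X = sym_eig q (transpose X ** gram A ** X) / real (CARD('p) choose q)"
  using assms by (simp add: objective_eq stiefel_def sym_eig_mat1)

lemma objective_rotate:
  fixes X :: "real^'p^'n"
  assumes "orthogonal_matrix U"
  shows "objective A q (X ** U) = objective A q X"
proof -
  have "transpose (X ** U) ** (X ** U) = transpose U ** (transpose X ** X) ** U"
    by (simp add: matrix_transpose_mul matrix_mul_assoc)
  then show ?thesis
    using assms by (simp add: objective_eq compression_rotate sym_eig_orthogonal_conj)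
qed

lemma inner_rotate:
  fixes X Y :: "real^'p^'n"
  assumes "orthogonal_matrix U"
  shows "(X ** U) \<bullet> (Y ** U) = X \<bullet> Y"
proof -
  have row: "(X ** U) $ i = transpose U *v (X $ i)" for X :: "real^'p^'n" and i
    by (simp add: matrix_matrix_mult_def matrix_vector_mult_def transpose_def vec_eq_iff mult.commute)
  have "orthogonal_transformation ((*v) (transpose U))"
    using assms by (simp add: orthogonal_transformation_matrix)
  then have "(transpose U *v x) \<bullet> (transpose U *v y) = x \<bullet> y" for x y
    by (simp add: orthogonal_transformation_def)
  then show ?thesis by (simp add: inner_vec_def[of X] inner_vec_def[of "X ** U"] row)
qed

lemma inner_transpose:
  fixes X Y :: "real^'p^'n"
  shows "transpose X \<bullet> transpose Y = X \<bullet> Y"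
  unfolding inner_vec_def transpose_def by simp (rule sum.swap)

lemma inner_conj:
  fixes B C :: "real^'p^'p"
  assumes "orthogonal_matrix U"
  shows "(transpose U ** B ** U) \<bullet> (transpose U ** C ** U) = B \<bullet> C"
proof -
  have "(transpose U ** B) \<bullet> (transpose U ** C) = (transpose B ** U) \<bullet> (transpose C ** U)"
    by (subst inner_transpose[symmetric]) (simp add: matrix_transpose_mul)
  then show ?thesis using assms by (simp add: inner_rotate inner_transpose)
qed

lemma dist_rotate:
  fixes X Y :: "real^'p^'n"
  assumes "orthogonal_matrix U"
  shows "dist (X ** U) (Y ** U) = dist X Y"
proof -
  have "X ** U - Y ** U = (X - Y) ** U"
    by (simp add: matrix_matrix_mult_def vec_eq_iff left_diff_distrib sum_subtractf)
  then show ?thesis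
    using inner_rotate[OF assms, of "X - Y" "X - Y"] by (simp add: dist_norm norm_eq_sqrt_inner)
qed

lemma eventually_stiefel_rotate:
  fixes X :: "real^'p^'n"
  assumes U: "orthogonal_matrix U" and ev: "\<forall>\<^sub>F Y in at X within stiefel. P Y"
  shows "\<forall>\<^sub>F Y in at (X ** U) within stiefel. P (Y ** transpose U)"
proof -
  obtain d where d: "d > 0" "\<And>Y. Y \<in> stiefel \<Longrightarrow> Y \<noteq> X \<Longrightarrow> dist Y X < d \<Longrightarrow> P Y"
    using ev unfolding eventually_at by blast
  have "P (Y ** transpose U)" if Y: "Y \<in> stiefel" "Y \<noteq> X ** U" "dist Y (X ** U) < d" for Y
  proof (rule d(2))
    show "Y ** transpose U \<in> stiefel" using Y U by (intro stiefel_rotate) auto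
    show "Y ** transpose U \<noteq> X" using Y(2) U by auto
    show "dist (Y ** transpose U) X < d"
      using Y(3) dist_rotate[OF U, of "Y ** transpose U" X] U by simp
  qed
  then show ?thesis unfolding eventually_at using d(1) by blast
qed

lemma local_max_rotate:
  fixes X :: "real^'p^'n"
  assumes "local_max A q X" "orthogonal_matrix U"
  shows "local_max A q (X ** U)"
  using assms eventually_stiefel_rotate[OF assms(2), where X = X and P = "\<lambda>Y. objective A q Y \<le> objective A q X"]
  by (simp add: local_max_def stiefel_rotate objective_rotate)

lemma local_min_rotate:
  fixes X :: "real^'p^'n"
  assumes "local_min A q X" "orthogonal_matrix U"
  shows "local_min A q (X ** U)"
  using assms eventually_stiefel_rotate[OF assms(2), where X = X and P = "\<lambda>Y. objective A q X \<le> objective A q Y"]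
  by (simp add: local_min_def stiefel_rotate objective_rotate)

lemma linear_rotate: "linear (\<lambda>Y :: real^'p^'n. Y ** (U :: real^'q^'p))"
  by (rule linearI) (simp_all add: matrix_mult_add_rdistrib scalar_matrix_assoc)

text \<open>The objective equals its composition with right multiplication by the transpose of
  \<open>U\<close>. The chain rule therefore turns the gradient into \<open>G ** U\<close>, and the
  multiplier has to be conjugated.\<close>

lemma lagrange_multiplier_rotate:
  fixes X :: "real^'p^'n"
  assumes L: "lagrange_multiplier A q X \<Lambda>" and U: "orthogonal_matrix U"
  shows "lagrange_multiplier A q (X ** U) (transpose U ** \<Lambda> ** U)"
proof -
  obtain G where sym: "transpose \<Lambda> = \<Lambda>" and G: "GDERIV (objective A q) X :> G" "G + 2 *\<^sub>R (X ** \<Lambda>) = 0"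
    using L by (auto simp: lagrange_multiplier_def)
  have "((\<lambda>Y. Y ** transpose U) has_derivative (\<lambda>Y. Y ** transpose U)) (at (X ** U))"
    by (intro linear_imp_has_derivative linear_rotate)
  moreover have "(objective A q has_derivative (\<lambda>h. h \<bullet> G)) (at (X ** U ** transpose U))"
    using G(1) U by (simp add: gderiv_def)
  ultimately have "((\<lambda>Y. objective A q (Y ** transpose U)) has_derivative (\<lambda>h. (h ** transpose U) \<bullet> G)) (at (X ** U))"
    by (rule has_derivative_compose)
  moreover have "(h ** transpose U) \<bullet> G = h \<bullet> (G ** U)" for h
    using inner_rotate[OF U, of "h ** transpose U" G] U by simp
  ultimately have "GDERIV (objective A q) (X ** U) :> G ** U"
    using U by (simp add: gderiv_def objective_rotate)
  moreover have "G ** U + 2 *\<^sub>R (X ** U ** (transpose U ** \<Lambda> ** U)) = (G + 2 *\<^sub>R (X ** \<Lambda>)) ** U"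
    using U by (simp add: matrix_mul_assoc matrix_mult_add_rdistrib scalar_matrix_assoc)
  ultimately have "GDERIV (objective A q) (X ** U) :> G ** U \<and>
      G ** U + 2 *\<^sub>R (X ** U ** (transpose U ** \<Lambda> ** U)) = 0"
    using G(2) linear_0[OF linear_rotate[of U]] by simp
  then show ?thesis
    using sym by (auto simp: lagrange_multiplier_def matrix_transpose_mul matrix_mul_assoc)
qed

lemma stationary_rotate:
  fixes X :: "real^'p^'n"
  assumes "stationary A q X" "orthogonal_matrix U"
  shows "stationary A q (X ** U)"
  using assms lagrange_multiplier_rotate stiefel_rotate unfolding stationary_def by blast

lemma lagrangian_rotate:
  fixes X :: "real^'p^'n"
  assumes U: "orthogonal_matrix U"
  shows "lagrangian A q (transpose U ** \<Lambda> ** U) (X ** U) = lagrangian A q \<Lambda> X"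
proof -
  have "transpose (X ** U) ** (X ** U) - mat 1 = transpose U ** (transpose X ** X - mat 1) ** U"
    using orthogonal_conj_affine[OF U, of "-1" 1 "transpose X ** X"]
    by (simp add: matrix_transpose_mul matrix_mul_assoc)
  then show ?thesis using U by (simp add: lagrangian_def objective_rotate inner_conj)
qed

lemma ascent_direction_rotate:
  fixes X :: "real^'p^'n"
  assumes asc: "ascent_direction A q X \<Delta>" and U: "orthogonal_matrix U"
  shows "ascent_direction A q (X ** U) (\<Delta> ** U)"
proof -
  obtain \<Lambda> \<phi> D where L: "lagrange_multiplier A q X \<Lambda>"
      "\<forall>\<^sub>F t in nhds 0. ((\<lambda>t. lagrangian A q \<Lambda> (X + t *\<^sub>R \<Delta>)) has_real_derivative \<phi> t) (at t)"
      "(\<phi> has_real_derivative D) (at 0)" "D > 0"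
    and tangent: "transpose X ** \<Delta> + transpose \<Delta> ** X = 0"
    using asc by (auto simp: ascent_direction_def)
  have "X ** U + t *\<^sub>R (\<Delta> ** U) = (X + t *\<^sub>R \<Delta>) ** U" for t
    by (simp add: matrix_mult_add_rdistrib scalar_matrix_assoc)
  then have "lagrangian A q (transpose U ** \<Lambda> ** U) (X ** U + t *\<^sub>R (\<Delta> ** U)) = lagrangian A q \<Lambda> (X + t *\<^sub>R \<Delta>)" for t
    by (simp add: lagrangian_rotate[OF U])
  moreover have "transpose (X ** U) ** (\<Delta> ** U) + transpose (\<Delta> ** U) ** (X ** U) = 0"
  proof -
    have "transpose (X ** U) ** (\<Delta> ** U) + transpose (\<Delta> ** U) ** (X ** U) =
        transpose U ** (transpose X ** \<Delta> + transpose \<Delta> ** X) ** U"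
      by (simp add: matrix_transpose_mul matrix_mul_assoc matrix_add_ldistrib matrix_mult_add_rdistrib)
    \<comment> \<open>With all three arguments 0 the conjugation rule says that the zero matrix is
      conjugated to itself.\<close>
    then show ?thesis using orthogonal_conj_affine[OF U, of 0 0 0] tangent by simp
  qed
  ultimately show ?thesis
    using lagrange_multiplier_rotate[OF L(1) U] L(2-4) unfolding ascent_direction_def
    by (intro conjI exI[of _ "transpose U ** \<Lambda> ** U"] exI[of _ \<phi>] exI[of _ D]) simp_all
qed

text \<open>The matched eigenvalues dominate one by one. Elementary symmetric polynomials are
  monotone on nonnegative arguments, which is where semidefiniteness of \<open>M\<close>
  enters.\<close>

lemma dominant_sym_eig_le:
  fixes X Y :: "real^'p^'n"
  assumes M: "transpose M = M" "\<And>v. 0 \<le> v \<bullet> (M *v v)"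
    and dom: "dominant_subspace M (col_range X)" and X: "X \<in> stiefel" and Y: "Y \<in> stiefel"
  shows "sym_eig q (transpose Y ** M ** Y) \<le> sym_eig q (transpose X ** M ** X)"
proof -
  obtain U b where U: "orthogonal_matrix U" "X ** U \<in> stiefel" "transpose (X ** U) ** M ** (X ** U) = diag_matrix b"
    using stiefel_diagonalise[OF X M(1)] by blast
  obtain V c where V: "orthogonal_matrix V" "Y ** V \<in> stiefel" "transpose (Y ** V) ** M ** (Y ** V) = diag_matrix c"
    using stiefel_diagonalise[OF Y M(1)] by blast
  have "dominant_subspace M (col_range (X ** U))" using dom U by (simp add: col_range_rotate)
  then obtain \<pi> where \<pi>: "bij \<pi>" "\<And>j. c j \<le> b (\<pi> j)"
    using dominant_bijection[OF M(1) _ U(2,3) V(2,3)] by blast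
  have "c j = column j (Y ** V) \<bullet> (M *v column j (Y ** V))" for j
    using V(3) by (metis compression_nth diag_matrix_nth)
  then have "0 \<le> c j" for j using M(2) by simp
  then have "esym q UNIV c \<le> esym q UNIV (\<lambda>j. b (\<pi> j))" using \<pi>(2) by (intro esym_mono) auto
  also have "\<dots> = esym q UNIV b" using esym_reindex[of \<pi> UNIV UNIV q b] \<pi>(1) by simp
  finally show ?thesis
    using U V by (metis compression_rotate sym_eig_diag sym_eig_orthogonal_conj)
qed

lemma transpose_uminus: "transpose (- M) = - transpose (M :: real^'n^'m)"
  by (simp add: transpose_def vec_eq_iff)

text \<open>Dominance and matching are insensitive to sign and can be used for \<open>- M\<close>;
  monotonicity is then applied to the eigenvalues of the compressions of \<open>M\<close> itself,
  which are nonnegative.\<close>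

lemma antidominant_sym_eig_ge:
  fixes X Y :: "real^'p^'n"
  assumes M: "transpose M = M" "\<And>v. 0 \<le> v \<bullet> (M *v v)"
    and dom: "dominant_subspace (- M) (col_range X)" and X: "X \<in> stiefel" and Y: "Y \<in> stiefel"
  shows "sym_eig q (transpose X ** M ** X) \<le> sym_eig q (transpose Y ** M ** Y)"
proof -
  have M': "transpose (- M) = - M" using M(1) by (simp add: transpose_uminus)
  have neg: "transpose Z ** (- M) ** Z = diag_matrix (\<lambda>i. - b i)"
    if "transpose Z ** M ** Z = diag_matrix b" for Z :: "real^'p^'n" and b
  proof -
    have "(transpose Z ** (- M) ** Z) $ i $ j = - ((transpose Z ** M ** Z) $ i $ j)" for i j
      by (simp add: compression_nth matrix_vector_mult_def vec_eq_iff inner_vec_def sum_negf)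
    then show ?thesis unfolding that by (simp add: vec_eq_iff diag_matrix_nth)
  qed
  obtain U b where U: "orthogonal_matrix U" "X ** U \<in> stiefel" "transpose (X ** U) ** M ** (X ** U) = diag_matrix b"
    using stiefel_diagonalise[OF X M(1)] by blast
  obtain V c where V: "orthogonal_matrix V" "Y ** V \<in> stiefel" "transpose (Y ** V) ** M ** (Y ** V) = diag_matrix c"
    using stiefel_diagonalise[OF Y M(1)] by blast
  have "dominant_subspace (- M) (col_range (X ** U))" using dom U by (simp add: col_range_rotate)
  then obtain \<pi> where \<pi>: "bij \<pi>" "\<And>j. - c j \<le> - b (\<pi> j)"
    using dominant_bijection[OF M' _ U(2) neg[OF U(3)] V(2) neg[OF V(3)]] by blast
  have "b j = column j (X ** U) \<bullet> (M *v column j (X ** U))" for j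
    using U(3) by (metis compression_nth diag_matrix_nth)
  then have "0 \<le> b j" for j using M(2) by simp
  then have "esym q UNIV (\<lambda>j. b (\<pi> j)) \<le> esym q UNIV c" using \<pi>(2) by (intro esym_mono) auto
  moreover have "esym q UNIV (\<lambda>j. b (\<pi> j)) = esym q UNIV b"
    using esym_reindex[of \<pi> UNIV UNIV q b] \<pi>(1) by simp
  ultimately show ?thesis
    using U V by (metis compression_rotate sym_eig_diag sym_eig_orthogonal_conj)
qed

section \<open>Dominant ranges give global extrema\<close>

lemma global_max_iff:
  fixes X :: "real^'p^'n"
  shows "global_max A q X \<longleftrightarrow> X \<in> stiefel \<and>
    (\<forall>Y\<in>stiefel. objective A q (Y :: real^'p^'n) \<le> objective A q X)"
  by (auto simp: global_max_def is_arg_max_def not_less)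

lemma global_min_iff:
  fixes X :: "real^'p^'n"
  shows "global_min A q X \<longleftrightarrow> X \<in> stiefel \<and>
    (\<forall>Y\<in>stiefel. objective A q X \<le> objective A q (Y :: real^'p^'n))"
  by (auto simp: global_min_def is_arg_min_def not_less)

lemma dominant_global_max:
  fixes X :: "real^'p^'n"
  assumes "X \<in> stiefel" "dominant_subspace (gram A) (col_range X)"
  shows "global_max A q X"
  using assms dominant_sym_eig_le[OF transpose_gram gram_form_nonneg assms(2,1)]
  by (auto simp: global_max_iff objective_stiefel intro!: divide_right_mono)

lemma antidominant_global_min:
  fixes X :: "real^'p^'n"
  assumes "X \<in> stiefel" "dominant_subspace (- gram A) (col_range X)"
  shows "global_min A q X"
  using assms antidominant_sym_eig_ge[OF transpose_gram gram_form_nonneg assms(2,1)]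
  by (auto simp: global_min_iff objective_stiefel intro!: divide_right_mono)

lemma global_max_imp_local_max: "global_max A q X \<Longrightarrow> local_max A q X"
  by (auto simp: global_max_iff local_max_def eventually_at_filter)

lemma global_min_imp_local_min: "global_min A q X \<Longrightarrow> local_min A q X"
  by (auto simp: global_min_iff local_min_def eventually_at_filter)

section \<open>Rotating a column\<close>

definition column_matrix :: "'p \<Rightarrow> real^'n \<Rightarrow> real^'p^'n" where
  "column_matrix i h = (\<chi> a j. if j = i then h $ a else 0)"

lemma column_column_matrix: "column j (column_matrix i h) = (if j = i then h else 0)"
  by (simp add: column_matrix_def column_def vec_eq_iff)

lemma linear_column_matrix: "linear (column_matrix i)"
  by (rule linearI) (simp_all add: column_matrix_def vec_eq_iff)

lemma column_add: "column j (X + Y) = column j X + column j Y"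
  by (simp add: column_def vec_eq_iff)

lemma inner_column_matrix:
  fixes X :: "real^'p^'n"
  shows "column_matrix i h \<bullet> X = h \<bullet> column i X"
proof -
  have "column_matrix i h $ a \<bullet> X $ a = h $ a * X $ a $ i" for a
  proof -
    have "column_matrix i h $ a \<bullet> X $ a = (\<Sum>j\<in>UNIV. if j = i then h $ a * X $ a $ i else 0)"
      unfolding inner_vec_def by (rule sum.cong) (auto simp: column_matrix_def)
    then show ?thesis by simp
  qed
  then show ?thesis by (simp add: inner_vec_def[of "column_matrix i h"] inner_vec_def[of h] column_def)
qed

text \<open>Written as \<open>Z\<close> plus a linear image, not by cases, so that curves of
  matrices can be differentiated through the column \<open>v\<close>.\<close>

definition with_column :: "real^'p^'n \<Rightarrow> 'p \<Rightarrow> real^'n \<Rightarrow> real^'p^'n" where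
  "with_column Z i v = Z + column_matrix i (v - column i Z)"

lemma column_with_column: "column j (with_column Z i v) = (if j = i then v else column j Z)"
  by (simp add: with_column_def column_add column_column_matrix)

lemma with_column_self: "with_column Z i (column i Z) = Z"
  by (simp add: with_column_def linear_0[OF linear_column_matrix])

lemma with_column_stiefel:
  assumes "Z \<in> stiefel" "norm v = 1" "\<And>j. j \<noteq> i \<Longrightarrow> v \<bullet> column j Z = 0"
  shows "with_column Z i v \<in> stiefel"
  using assms unfolding stiefel_iff orthonormal_on_def
  by (auto simp: column_with_column norm_eq_1 inner_commute)

text \<open>A rotation in the plane of column \<open>i\<close> and \<open>y\<close>. For a normal
  unit vector \<open>y\<close> it stays in the Stiefel manifold, so local extremality can be tested
  along it.\<close>

definition rotated :: "real^'p^'n \<Rightarrow> 'p \<Rightarrow> real^'n \<Rightarrow> real \<Rightarrow> real^'p^'n" where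
  "rotated Z i y t = with_column Z i (cos t *\<^sub>R column i Z + sin t *\<^sub>R y)"

definition normal_unit :: "real^'p^'n \<Rightarrow> real^'n \<Rightarrow> bool" where
  "normal_unit Z y \<longleftrightarrow> norm y = 1 \<and> (\<forall>j. y \<bullet> column j Z = 0)"

lemma rotated_0: "rotated Z i y 0 = Z"
  by (simp add: rotated_def with_column_self)

lemma rotated_stiefel:
  assumes Z: "Z \<in> stiefel" and y: "normal_unit Z y"
  shows "rotated Z i y t \<in> stiefel"
  unfolding rotated_def
proof (rule with_column_stiefel[OF Z])
  have z: "column j Z \<bullet> column k Z = (if j = k then 1 else 0)" for j k
    using Z by (auto simp: stiefel_iff orthonormal_on_def)
  have y': "y \<bullet> y = 1" "y \<bullet> column j Z = 0" "column j Z \<bullet> y = 0" for j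
    using y by (auto simp: normal_unit_def norm_eq_1 inner_commute)
  show "norm (cos t *\<^sub>R column i Z + sin t *\<^sub>R y) = 1"
    using sin_cos_squared_add2[of t]
    by (simp add: norm_eq_1 inner_add_left inner_add_right z y' power2_eq_square)
  show "(cos t *\<^sub>R column i Z + sin t *\<^sub>R y) \<bullet> column j Z = 0" if "j \<noteq> i" for j
    using that by (simp add: inner_add_left z y')
qed

lemma rotated_has_vector_derivative:
  "((rotated Z i y) has_vector_derivative column_matrix i y) (at 0)"
proof -
  have "((\<lambda>t. cos t *\<^sub>R column i Z + sin t *\<^sub>R y - column i Z) has_vector_derivative y) (at 0)"
    by (auto intro!: derivative_eq_intros simp: has_real_derivative_iff_has_vector_derivative[symmetric])
  from bounded_linear.has_vector_derivative[OF linear_column_matrix[of i, unfolded linear_conv_bounded_linear] this]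
  show ?thesis
    unfolding rotated_def with_column_def by (auto intro!: derivative_eq_intros)
qed

lemma inner_column_eigen:
  fixes Z :: "real^'p^'n"
  assumes "transpose Z ** M ** Z = diag_matrix b"
  shows "column i Z \<bullet> (M *v column j Z) = (if i = j then b i else 0)"
  using assms by (metis compression_nth diag_matrix_nth)

text \<open>At t = 0 column \<open>i\<close> moves with velocity \<open>y\<close>, so the
  compression changes to first order only in row and column \<open>i\<close>. Since it starts
  diagonal, only the entry at (i, i) counts.\<close>

lemma sym_eig_rotated_derivative:
  fixes Z :: "real^'p^'n"
  assumes "q \<ge> 1" and M: "transpose M = M" and diag: "transpose Z ** M ** Z = diag_matrix b"
  shows "((\<lambda>t. sym_eig q (transpose (rotated Z i y t) ** M ** rotated Z i y t)) has_real_derivative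
    2 * (y \<bullet> (M *v column i Z)) * esym (q - 1) (UNIV - {i}) b) (at 0)"
proof -
  let ?v = "\<lambda>t. cos t *\<^sub>R column i Z + sin t *\<^sub>R y"
  let ?B = "\<lambda>t. transpose (rotated Z i y t) ** M ** rotated Z i y t"
  let ?B' = "\<lambda>j k. if j = i \<and> k = i then 2 * (y \<bullet> (M *v column i Z))
    else if j = i then y \<bullet> (M *v column k Z) else if k = i then column j Z \<bullet> (M *v y) else 0"
  have col: "column j (rotated Z i y t) = (if j = i then ?v t else column j Z)" for j t
    by (simp add: rotated_def column_with_column)
  have "((\<lambda>t. ?B t $ j $ k) has_real_derivative ?B' j k) (at 0)" for j k
  proof -
    note expand = compression_nth col matrix_vector_right_distrib matrix_vector_mult_scaleR
      inner_add_left inner_add_right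
    consider "j = i" "k = i" | "j = i" "k \<noteq> i" | "j \<noteq> i" "k = i" | "j \<noteq> i" "k \<noteq> i" by blast
    then show ?thesis
    proof cases
      case 1
      have "((\<lambda>t. (cos t)\<^sup>2 * (column i Z \<bullet> (M *v column i Z)) + 2 * cos t * sin t * (y \<bullet> (M *v column i Z)) +
          (sin t)\<^sup>2 * (y \<bullet> (M *v y))) has_real_derivative ?B' j k) (at 0)"
        using 1 by (auto intro!: derivative_eq_intros)
      moreover have "?B t $ j $ k = (cos t)\<^sup>2 * (column i Z \<bullet> (M *v column i Z)) +
          2 * cos t * sin t * (y \<bullet> (M *v column i Z)) + (sin t)\<^sup>2 * (y \<bullet> (M *v y))" for t
        using 1 symmetric_dot[OF M, of "column i Z" y]
        by (simp add: expand power2_eq_square inner_commute algebra_simps)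
      ultimately show ?thesis by simp
    qed (auto simp: expand intro!: derivative_eq_intros)
  qed
  from sym_eig_has_derivative_at_diagonal[OF assms(1) transpose_compression[OF M] _ this, of b i]
  show ?thesis by (simp add: rotated_0 diag)
qed

text \<open>At least q entries are positive, and removing one index leaves at least q - 1 of
  them.\<close>

lemma esym_remove_pos:
  fixes b :: "'i::finite \<Rightarrow> real"
  assumes "q \<ge> 1" "\<And>i. 0 \<le> b i" "esym q UNIV b > 0"
  shows "esym (q - 1) (UNIV - {i}) b > 0"
proof -
  have "q \<le> card {j. b j > 0}" using assms esym_pos_iff[of UNIV b q] by simp
  moreover have "card {j. b j > 0} \<le> card (insert i {j \<in> UNIV - {i}. b j > 0})"
    by (intro card_mono) auto
  moreover have "card (insert i {j \<in> UNIV - {i}. b j > 0}) \<le> Suc (card {j \<in> UNIV - {i}. b j > 0})"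
    by (rule card_insert_le_m1) auto
  ultimately have "q - 1 \<le> card {j \<in> UNIV - {i}. b j > 0}" by linarith
  then show ?thesis using assms(2) by (subst esym_pos_iff) auto
qed

section \<open>First-order conditions along rotations\<close>

lemma rotated_near:
  assumes Z: "Z \<in> stiefel" and y: "normal_unit Z y"
    and ev: "\<forall>\<^sub>F Y in at Z within stiefel. P Y" and PZ: "P Z"
  shows "\<exists>d>0. \<forall>t. \<bar>t\<bar> < d \<longrightarrow> P (rotated Z i y t)"
proof -
  obtain e where e: "e > 0" "\<And>Y. Y \<in> stiefel \<Longrightarrow> Y \<noteq> Z \<Longrightarrow> dist Y Z < e \<Longrightarrow> P Y"
    using ev unfolding eventually_at by blast
  have "isCont (rotated Z i y) 0"
    using rotated_has_vector_derivative has_vector_derivative_continuous by blast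
  then obtain d where d: "d > 0" "\<And>t. \<bar>t\<bar> < d \<Longrightarrow> dist (rotated Z i y t) Z < e"
    unfolding continuous_at_eps_delta using e(1) by (auto simp: rotated_0)
  have "P (rotated Z i y t)" if "\<bar>t\<bar> < d" for t
    using e(2)[OF rotated_stiefel[OF Z y] _ d(2)[OF that]] PZ by metis
  then show ?thesis using d(1) by blast
qed

text \<open>The Lagrange condition puts the columns of the gradient into the range of
  \<open>Z\<close>, to which \<open>y\<close> is orthogonal.\<close>

lemma stationary_normal_derivative:
  assumes L: "stationary A q Z" and y: "normal_unit Z y"
  shows "((\<lambda>t. objective A q (rotated Z i y t)) has_real_derivative 0) (at 0)"
proof -
  obtain \<Lambda> G where G: "GDERIV (objective A q) Z :> G" "G + 2 *\<^sub>R (Z ** \<Lambda>) = 0"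
    using L by (auto simp: stationary_def lagrange_multiplier_def)
  have "((\<lambda>t. objective A q (rotated Z i y t)) has_derivative (\<lambda>t. (t *\<^sub>R column_matrix i y) \<bullet> G)) (at 0)"
    using has_derivative_compose[OF rotated_has_vector_derivative[of Z i y, unfolded has_vector_derivative_def],
        of "objective A q" "\<lambda>h. h \<bullet> G"] G(1)
    by (simp add: gderiv_def rotated_0)
  moreover have "column_matrix i y \<bullet> G = 0"
  proof -
    have "G = - 2 *\<^sub>R (Z ** \<Lambda>)" using G(2) by (simp add: eq_neg_iff_add_eq_0)
    moreover have "y \<bullet> (Z *v u) = 0" for u
      using y by (simp add: normal_unit_def matrix_mult_sum inner_sum_right scalar_mult_eq_scaleR)
    ultimately show ?thesis by (simp add: inner_column_matrix[of i y "Z ** \<Lambda>"] column_mult)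
  qed
  ultimately show ?thesis by (simp add: has_field_derivative_def lambda_zero)
qed

text \<open>Local maxima, local minima and stationary points enter together, so that the eigenvector
  property is derived once for all three.\<close>

lemma critical_normal_derivative:
  assumes crit: "local_max A q Z \<or> local_min A q Z \<or> stationary A q Z" and Z: "Z \<in> stiefel"
    and y: "normal_unit Z y"
    and D: "((\<lambda>t. objective A q (rotated Z i y t)) has_real_derivative D) (at 0)"
  shows "D = 0"
proof -
  consider "local_max A q Z" | "local_min A q Z" | "stationary A q Z" using crit by blast
  then show ?thesis
  proof cases
    case 1
    then obtain d where "d > 0" "\<And>t. \<bar>t\<bar> < d \<Longrightarrow> objective A q (rotated Z i y t) \<le> objective A q Z"
      using rotated_near[OF Z y, of "\<lambda>Y. objective A q Y \<le> objective A q Z" i]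
      by (auto simp: local_max_def)
    then show ?thesis by (intro DERIV_local_max[OF D]) (auto simp: rotated_0)
  next
    case 2
    then obtain d where "d > 0" "\<And>t. \<bar>t\<bar> < d \<Longrightarrow> objective A q Z \<le> objective A q (rotated Z i y t)"
      using rotated_near[OF Z y, of "\<lambda>Y. objective A q Z \<le> objective A q Y" i]
      by (auto simp: local_min_def)
    then show ?thesis by (intro DERIV_local_min[OF D]) (auto simp: rotated_0)
  next
    case 3
    then show ?thesis using D stationary_normal_derivative[OF 3 y] DERIV_unique by blast
  qed
qed

lemma binomial_pos_real: "q \<le> n \<Longrightarrow> 0 < real (n choose q)"
  by simp

text \<open>Because the compression is diagonal, the residual \<open>r\<close> of column
  \<open>i\<close> is orthogonal to the whole frame. A nonzero residual would, after normalisation,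
  be an admissible direction whose derivative is a positive multiple of \<open>norm r\<close> times
  a positive leave-one-out polynomial.\<close>

lemma critical_columns_eigenvectors:
  fixes Z :: "real^'p^'n"
  assumes crit: "local_max A q Z \<or> local_min A q Z \<or> stationary A q Z" and Z: "Z \<in> stiefel"
    and diag: "transpose Z ** gram A ** Z = diag_matrix b"
    and q: "q \<ge> 1" "q \<le> CARD('p)" and pos: "esym q UNIV b > 0"
  shows "gram A *v column i Z = b i *\<^sub>R column i Z"
proof (rule ccontr)
  note zM = inner_column_eigen[OF diag]
  have z: "column j Z \<bullet> column k Z = (if j = k then 1 else 0)" for j k
    using Z by (auto simp: stiefel_iff orthonormal_on_def)
  have b0: "0 \<le> b j" for j using gram_form_nonneg[of "column j Z" A] zM[of j j] by simp
  define r where "r = gram A *v column i Z - b i *\<^sub>R column i Z"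
  assume "gram A *v column i Z \<noteq> b i *\<^sub>R column i Z"
  then have r0: "r \<noteq> 0" by (simp add: r_def)
  have rz: "r \<bullet> column j Z = 0" for j
  proof -
    have "r \<bullet> column j Z = column j Z \<bullet> (gram A *v column i Z) - b i * (column j Z \<bullet> column i Z)"
      unfolding r_def inner_commute[of _ "column j Z"] by (simp add: inner_diff_right)
    then show ?thesis using zM[of j i] z[of j i] by simp
  qed
  define y where "y = r /\<^sub>R norm r"
  have y: "normal_unit Z y" using r0 rz by (simp add: normal_unit_def y_def)
  have "y \<bullet> (gram A *v column i Z) = y \<bullet> (r + b i *\<^sub>R column i Z)" by (simp add: r_def)
  also have "\<dots> = norm r"
    using r0 rz by (simp add: y_def inner_add_right dot_square_norm power2_eq_square)
  finally have yM: "y \<bullet> (gram A *v column i Z) = norm r" .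
  have "((\<lambda>t. objective A q (rotated Z i y t)) has_real_derivative
      2 * (y \<bullet> (gram A *v column i Z)) * esym (q - 1) (UNIV - {i}) b / real (CARD('p) choose q)) (at 0)"
    unfolding objective_stiefel[OF rotated_stiefel[OF Z y]]
    by (intro DERIV_cdivide sym_eig_rotated_derivative q(1) transpose_gram diag)
  from critical_normal_derivative[OF crit Z y this] have "norm r * esym (q - 1) (UNIV - {i}) b = 0"
    using binomial_pos_real[OF q(2)] unfolding yM by simp
  then show False using r0 esym_remove_pos[OF q(1) b0 pos, of i] by simp
qed

text \<open>The rotation keeps the compression diagonal and replaces one entry by a convex
  combination of \<open>b i\<close> and \<mu>. As the elementary symmetric polynomial is affine in
  that entry, the formula is exact for every \<open>t\<close>, not only to second order.\<close>

lemma objective_rotated_eigen: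
  fixes Z :: "real^'p^'n"
  assumes Z: "Z \<in> stiefel" and y: "normal_unit Z y" and q: "q \<ge> 1"
    and eig: "\<And>j. gram A *v column j Z = b j *\<^sub>R column j Z" and ym: "gram A *v y = \<mu> *\<^sub>R y"
  shows "objective A q (rotated Z i y t) =
    objective A q Z + (sin t)\<^sup>2 * ((\<mu> - b i) * esym (q - 1) (UNIV - {i}) b / real (CARD('p) choose q))"
proof -
  let ?v = "\<lambda>t. cos t *\<^sub>R column i Z + sin t *\<^sub>R y"
  have z: "column j Z \<bullet> column k Z = (if j = k then 1 else 0)" for j k
    using Z by (auto simp: stiefel_iff orthonormal_on_def)
  have y': "y \<bullet> y = 1" "y \<bullet> column j Z = 0" "column j Z \<bullet> y = 0" for j
    using y by (auto simp: normal_unit_def norm_eq_1 inner_commute)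
  have diag: "transpose (rotated Z i y t) ** gram A ** rotated Z i y t =
      diag_matrix (b(i := (cos t)\<^sup>2 * b i + (sin t)\<^sup>2 * \<mu>))" for t
  proof -
    have "(transpose (rotated Z i y t) ** gram A ** rotated Z i y t) $ j $ k =
        diag_matrix (b(i := (cos t)\<^sup>2 * b i + (sin t)\<^sup>2 * \<mu>)) $ j $ k" for j k
      by (simp add: compression_nth rotated_def column_with_column matrix_vector_right_distrib
          matrix_vector_mult_scaleR eig ym inner_add_left inner_add_right z y' diag_matrix_nth power2_eq_square)
    then show ?thesis by (simp add: vec_eq_iff)
  qed
  have "sym_eig q (transpose (rotated Z i y t) ** gram A ** rotated Z i y t) =
      esym q (UNIV - {i}) b + ((cos t)\<^sup>2 * b i + (sin t)\<^sup>2 * \<mu>) * esym (q - 1) (UNIV - {i}) b" for t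
    unfolding diag sym_eig_diag esym_update[OF q] ..
  \<comment> \<open>Comparison with the instance at 0 eliminates the summand that is free of entry
    \<open>i\<close>.\<close>
  from this[of t] this[of 0] have "sym_eig q (transpose (rotated Z i y t) ** gram A ** rotated Z i y t) =
      sym_eig q (transpose Z ** gram A ** Z) + (sin t)\<^sup>2 * ((\<mu> - b i) * esym (q - 1) (UNIV - {i}) b)"
    by (simp add: rotated_0 cos_squared_eq algebra_simps)
  then show ?thesis
    unfolding objective_stiefel[OF rotated_stiefel[OF Z y]] objective_stiefel[OF Z]
    by (simp add: add_divide_distrib)
qed

lemma local_max_eigenvalue_bound:
  fixes Z :: "real^'p^'n"
  assumes Z: "Z \<in> stiefel" "local_max A q Z" and y: "normal_unit Z y" and q: "q \<ge> 1" "q \<le> CARD('p)"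
    and eig: "\<And>j. gram A *v column j Z = b j *\<^sub>R column j Z" and ym: "gram A *v y = \<mu> *\<^sub>R y"
    and pos: "esym (q - 1) (UNIV - {i}) b > 0"
  shows "\<mu> \<le> b i"
proof (rule ccontr)
  assume "\<not> \<mu> \<le> b i"
  then have c: "(\<mu> - b i) * esym (q - 1) (UNIV - {i}) b / real (CARD('p) choose q) > 0"
    using pos binomial_pos_real[OF q(2)] by simp
  obtain d where d: "d > 0" "\<And>t. \<bar>t\<bar> < d \<Longrightarrow> objective A q (rotated Z i y t) \<le> objective A q Z"
    using rotated_near[OF Z(1) y, of "\<lambda>Y. objective A q Y \<le> objective A q Z" i] Z(2)
    by (auto simp: local_max_def)
  \<comment> \<open>Any t in (0, pi) inside the neighbourhood would do: there sin t is positive, and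
    the exact formula gives a strict increase.\<close>
  define t where "t = min (d / 2) 1"
  have t: "0 < t" "t < pi" "\<bar>t\<bar> < d" using d(1) pi_gt3 by (auto simp: t_def min_def)
  then have sin: "(sin t)\<^sup>2 > 0" using sin_gt_zero[of t] by simp
  then show False
    using mult_pos_pos[OF sin c] d(2)[OF t(3)] objective_rotated_eigen[OF Z(1) y q(1) eig ym, of i t] by linarith
qed

lemma local_min_eigenvalue_bound:
  fixes Z :: "real^'p^'n"
  assumes Z: "Z \<in> stiefel" "local_min A q Z" and y: "normal_unit Z y" and q: "q \<ge> 1" "q \<le> CARD('p)"
    and eig: "\<And>j. gram A *v column j Z = b j *\<^sub>R column j Z" and ym: "gram A *v y = \<mu> *\<^sub>R y"
    and pos: "esym (q - 1) (UNIV - {i}) b > 0"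
  shows "b i \<le> \<mu>"
proof (rule ccontr)
  assume "\<not> b i \<le> \<mu>"
  then have c: "(\<mu> - b i) * esym (q - 1) (UNIV - {i}) b / real (CARD('p) choose q) < 0"
    using pos binomial_pos_real[OF q(2)] by (simp add: divide_less_0_iff mult_less_0_iff)
  obtain d where d: "d > 0" "\<And>t. \<bar>t\<bar> < d \<Longrightarrow> objective A q Z \<le> objective A q (rotated Z i y t)"
    using rotated_near[OF Z(1) y, of "\<lambda>Y. objective A q Z \<le> objective A q Y" i] Z(2)
    by (auto simp: local_min_def)
  define t where "t = min (d / 2) 1"
  have t: "0 < t" "t < pi" "\<bar>t\<bar> < d" using d(1) pi_gt3 by (auto simp: t_def min_def)
  then have sin: "(sin t)\<^sup>2 > 0" using sin_gt_zero[of t] by simp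
  then show False
    using mult_pos_neg[OF sin c] d(2)[OF t(3)] objective_rotated_eigen[OF Z(1) y q(1) eig ym, of i t] by linarith
qed

text \<open>The complement of the range is invariant by symmetry, so its Rayleigh maximiser is a
  normal eigenvector, and the bound on this single eigenvalue controls the form on the whole
  complement. The separating threshold is the least \<open>b\<close>.\<close>

lemma dominant_subspaceI:
  fixes Z :: "real^'p^'n"
  assumes M: "transpose M = M" and Z: "Z \<in> stiefel"
    and eig: "\<And>j. M *v column j Z = b j *\<^sub>R column j Z"
    and bound: "\<And>i y \<mu>. normal_unit Z y \<Longrightarrow> M *v y = \<mu> *\<^sub>R y \<Longrightarrow> \<mu> \<le> b i"
  shows "dominant_subspace M (col_range Z)"
  unfolding dominant_subspace_def
proof (intro conjI exI[of _ "Min (range b)"] ballI)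
  let ?S = "col_range Z"
  have z: "orthonormal_on UNIV (\<lambda>i. column i Z)" using Z by (simp add: stiefel_iff)
  show S: "subspace ?S" by (simp add: col_range_def)
  have "?S \<subseteq> {v. M *v v \<in> ?S}"
    unfolding col_range_eq
  proof (rule span_minimal)
    show "range (\<lambda>i. column i Z) \<subseteq> {v. M *v v \<in> span (range (\<lambda>i. column i Z))}"
      by (auto simp: eig intro!: span_scale span_base[OF rangeI])
    show "subspace {v. M *v v \<in> span (range (\<lambda>i. column i Z))}"
      by (auto simp: subspace_def matrix_vector_right_distrib matrix_vector_mult_scaleR span_add span_scale span_zero)
  qed
  then show inv: "M *v v \<in> ?S" if "v \<in> ?S" for v using that by blast
  show "Min (range b) * (v \<bullet> v) \<le> v \<bullet> (M *v v)" if "v \<in> ?S" for v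
    using that z unfolding col_range_eq
    by (intro orthonormal_form_lower[where I = UNIV and x = "\<lambda>i. column i Z" and b = b])
      (auto simp: eig orthonormal_on_def)
  fix v assume v: "v \<in> orthogonal_comp ?S"
  show "v \<bullet> (M *v v) \<le> Min (range b) * (v \<bullet> v)"
  proof (cases "orthogonal_comp ?S = {0}")
    case False
    have inv': "M *v w \<in> orthogonal_comp ?S" if "w \<in> orthogonal_comp ?S" for w
      using that inv symmetric_dot[OF M] by (auto simp: orthogonal_comp_def orthogonal_def) metis
    obtain y \<mu> where y: "y \<in> orthogonal_comp ?S" "norm y = 1" "M *v y = \<mu> *\<^sub>R y"
      and max: "\<And>v. v \<in> orthogonal_comp ?S \<Longrightarrow> v \<bullet> (M *v v) \<le> \<mu> * (v \<bullet> v)"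
      using rayleigh_max[OF M subspace_orthogonal_comp False inv'] by metis
    have "column j Z \<in> ?S" for j unfolding col_range_eq by (intro span_base) auto
    then have "normal_unit Z y"
      using y by (auto simp: normal_unit_def orthogonal_comp_def orthogonal_def inner_commute)
    then have "\<mu> \<le> Min (range b)" using bound y(3) by auto
    then have "\<mu> * (v \<bullet> v) \<le> Min (range b) * (v \<bullet> v)" by (intro mult_right_mono) auto
    then show ?thesis using max[OF v] by linarith
  qed (use v in auto)
qed

section \<open>Local extrema with positive objective\<close>

lemma matrix_vector_uminus: "(- M) *v x = - (M *v (x :: real^'n))"
  by (simp add: matrix_vector_mult_def vec_eq_iff sum_negf)

lemma local_max_positive_dominant:
  fixes X :: "real^'p^'n"
  assumes X: "local_max A q X" and q: "q \<ge> 1" "q \<le> CARD('p)"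
    and pos: "sym_eig q (transpose X ** gram A ** X) > 0"
  shows "dominant_subspace (gram A) (col_range X)"
proof -
  have "X \<in> stiefel" using X by (simp add: local_max_def)
  then obtain U b where U: "orthogonal_matrix U" "X ** U \<in> stiefel"
    "transpose (X ** U) ** gram A ** (X ** U) = diag_matrix b"
    using stiefel_diagonalise[OF _ transpose_gram] by blast
  have lm: "local_max A q (X ** U)" using local_max_rotate[OF X U(1)] .
  have pos': "esym q UNIV b > 0"
    using pos U by (metis compression_rotate sym_eig_diag sym_eig_orthogonal_conj)
  have b0: "0 \<le> b j" for j
    using gram_form_nonneg[of "column j (X ** U)" A] inner_column_eigen[OF U(3), of j j] by simp
  have eig: "gram A *v column j (X ** U) = b j *\<^sub>R column j (X ** U)" for j
    using critical_columns_eigenvectors[OF _ U(2,3) q pos'] lm by blast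
  have "dominant_subspace (gram A) (col_range (X ** U))"
    using local_max_eigenvalue_bound[OF U(2) lm _ q eig _ esym_remove_pos[OF q(1) b0 pos']]
    by (intro dominant_subspaceI[OF transpose_gram U(2) eig])
  then show ?thesis using U(1) by (simp add: col_range_rotate)
qed

text \<open>Passing to \<open>- gram A\<close> turns the lower bound on normal eigenvalues into the
  upper bound that dominance asks for.\<close>

lemma local_min_positive_antidominant:
  fixes X :: "real^'p^'n"
  assumes X: "local_min A q X" and q: "q \<ge> 1" "q \<le> CARD('p)"
    and pos: "sym_eig q (transpose X ** gram A ** X) > 0"
  shows "dominant_subspace (- gram A) (col_range X)"
proof -
  have "X \<in> stiefel" using X by (simp add: local_min_def)
  then obtain U b where U: "orthogonal_matrix U" "X ** U \<in> stiefel"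
    "transpose (X ** U) ** gram A ** (X ** U) = diag_matrix b"
    using stiefel_diagonalise[OF _ transpose_gram] by blast
  have lm: "local_min A q (X ** U)" using local_min_rotate[OF X U(1)] .
  have pos': "esym q UNIV b > 0"
    using pos U by (metis compression_rotate sym_eig_diag sym_eig_orthogonal_conj)
  have b0: "0 \<le> b j" for j
    using gram_form_nonneg[of "column j (X ** U)" A] inner_column_eigen[OF U(3), of j j] by simp
  have eig: "gram A *v column j (X ** U) = b j *\<^sub>R column j (X ** U)" for j
    using critical_columns_eigenvectors[OF _ U(2,3) q pos'] lm by blast
  have "dominant_subspace (- gram A) (col_range (X ** U))"
  proof (rule dominant_subspaceI[OF _ U(2), where b = "\<lambda>j. - b j"])
    show "- gram A *v column j (X ** U) = - b j *\<^sub>R column j (X ** U)" for j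
      by (simp add: matrix_vector_uminus eig)
    fix i y \<mu> assume y: "normal_unit (X ** U) y" "- gram A *v y = \<mu> *\<^sub>R y"
    then have "gram A *v y = (- \<mu>) *\<^sub>R y" by (simp add: matrix_vector_uminus minus_equation_iff)
    from local_min_eigenvalue_bound[OF U(2) lm y(1) q eig this esym_remove_pos[OF q(1) b0 pos']]
    show "\<mu> \<le> - b i" by (simp add: le_minus_iff)
  qed (simp add: transpose_uminus)
  then show ?thesis using U(1) by (simp add: col_range_rotate)
qed

section \<open>Frames of deficient rank\<close>

lemma compression_gram: "transpose X ** gram A ** X = gram (A ** X)"
  by (simp add: gram_def matrix_transpose_mul matrix_mul_assoc)

lemma rank_col_range: "rank (X :: real^'p^'n) = dim (col_range X)"
  by (simp add: column_rank_def col_range_def)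

lemma rank_mult_le:
  fixes A :: "real^'n^'m" and X :: "real^'p^'n"
  shows "rank (A ** X) \<le> rank A"
  unfolding rank_col_range
  by (rule dim_subset) (auto simp: col_range_range simp flip: matrix_vector_mul_assoc)

text \<open>The columns of \<open>C ** U\<close> are orthogonal with squared lengths
  \<open>d i\<close>; those of positive length, normalised, form an orthonormal basis of the range,
  and the others vanish.\<close>

lemma rank_gram_diag:
  fixes C :: "real^'p^'m"
  assumes "orthogonal_matrix U" "transpose U ** gram C ** U = diag_matrix d"
  shows "rank C = card {i. d i > 0}"
proof -
  let ?c = "\<lambda>i. column i (C ** U)"
  have c: "?c i \<bullet> ?c j = (if i = j then d i else 0)" for i j
    using assms(2) by (metis compression_gram diag_matrix_nth gram_def transpose_mult_nth)
  have d0: "0 \<le> d i" for i using c[of i i] by (metis inner_ge_zero)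
  let ?I = "{i. d i > 0}"
  let ?x = "\<lambda>i. ?c i /\<^sub>R sqrt (d i)"
  have "orthonormal_on ?I ?x"
    by (auto simp: orthonormal_on_def c divide_simps)
  then have dim: "dim (span (?x ` ?I)) = card ?I" by (intro orthonormal_on_dim) auto
  have "col_range (C ** U) = span (?x ` ?I)"
    unfolding col_range_eq
  proof (rule span_eq[THEN iffD2], intro conjI subsetI)
    fix v assume "v \<in> range ?c"
    then obtain i where v: "v = ?c i" by blast
    show "v \<in> span (?x ` ?I)"
    proof (cases "d i > 0")
      case True
      then have "v = sqrt (d i) *\<^sub>R ?x i" by (simp add: v)
      then show ?thesis using True span_scale[OF span_base, of "?x i" "?x ` ?I" "sqrt (d i)"] by auto
    next
      case False
      then have "v = 0" using c[of i i] d0[of i] v by simp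
      then show ?thesis by (simp add: span_zero)
    qed
  next
    fix v assume "v \<in> ?x ` ?I"
    then show "v \<in> span (range ?c)" by (auto intro!: span_scale span_base[OF rangeI])
  qed
  then show ?thesis using dim assms(1) by (metis rank_col_range col_range_rotate)
qed

text \<open>This identifies the degenerate frames, to which the first-order argument does not apply,
  as those for which \<open>A ** X\<close> has rank below q.\<close>

lemma sym_eig_gram_pos_iff:
  fixes C :: "real^'p^'m"
  shows "sym_eig q (gram C) > 0 \<longleftrightarrow> q \<le> rank C"
proof -
  obtain U d where U: "orthogonal_matrix U" "transpose U ** gram C ** U = diag_matrix d"
    using symmetric_diagonalise[OF transpose_gram] by blast
  have "0 \<le> d i" for i
    using gram_form_nonneg[of "column i U" C] compression_nth[of U "gram C" i i] unfolding U(2)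
    by (simp add: diag_matrix_nth)
  then have "esym q UNIV d > 0 \<longleftrightarrow> q \<le> card {i. d i > 0}" by (subst esym_pos_iff) auto
  then show ?thesis
    using rank_gram_diag[OF U] sym_eig_orthogonal_conj[OF U(1), of q "gram C"] by (simp add: U(2) sym_eig_diag)
qed

lemma sym_eig_gram_nonneg:
  fixes C :: "real^'p^'m"
  shows "0 \<le> sym_eig q (gram C)"
proof -
  obtain U d where U: "orthogonal_matrix U" "transpose U ** gram C ** U = diag_matrix d"
    using symmetric_diagonalise[OF transpose_gram] by blast
  have "0 \<le> d i" for i
    using gram_form_nonneg[of "column i U" C] compression_nth[of U "gram C" i i] unfolding U(2)
    by (simp add: diag_matrix_nth)
  then have "0 \<le> esym q UNIV d" by (intro esym_nonneg)
  then show ?thesis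
    using sym_eig_orthogonal_conj[OF U(1), of q "gram C"] by (simp add: U(2) sym_eig_diag)
qed

text \<open>A deficient frame has, after rotation, a column that \<open>A\<close> annihilates.
  Rotating it slightly towards a normal vector whose image lies outside the range of
  \<open>A ** Z\<close> keeps that range and adds a new direction to it.\<close>

lemma raise_rank:
  fixes X :: "real^'p^'n" and A :: "real^'n^'m"
  assumes X: "X \<in> stiefel" and less: "rank (A ** X) < CARD('p)" "rank (A ** X) < rank A" and e: "e > 0"
  shows "\<exists>Y\<in>stiefel. dist Y X < e \<and> rank (A ** X) < rank (A ** Y)"
proof -
  obtain U b where U: "orthogonal_matrix U" "X ** U \<in> stiefel"
    "transpose (X ** U) ** gram A ** (X ** U) = diag_matrix b"
    using stiefel_diagonalise[OF X transpose_gram] by blast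
  define Z where "Z = X ** U"
  have Z: "Z \<in> stiefel" "transpose Z ** gram A ** Z = diag_matrix b" using U by (simp_all add: Z_def)
  have rk: "rank (A ** (Y ** V)) = rank (A ** Y)" if "orthogonal_matrix V" for Y :: "real^'p^'n" and V
    using that by (simp add: rank_col_range matrix_mul_assoc col_range_rotate)
  have b: "b i = (A *v column i Z) \<bullet> (A *v column i Z)" for i
    using inner_column_eigen[OF Z(2), of i i] by (simp add: gram_form)
  have "transpose U ** gram (A ** X) ** U = diag_matrix b"
    using U(3) by (simp add: compression_gram[symmetric] compression_rotate)
  then have "card {i. b i > 0} < CARD('p)" using less(1) rank_gram_diag[OF U(1)] by metis
  then have "{i. b i > 0} \<noteq> UNIV" by auto
  then obtain i where "\<not> b i > 0" by auto
  then have Az: "A *v column i Z = 0" using b[of i] by (simp add: not_less)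
  let ?R = "col_range (A ** Z)"
  have R: "subspace ?R" by (simp add: col_range_def)
  have "\<not> col_range A \<subseteq> ?R"
    using less(2) rk[OF U(1), of X] dim_subset[of "col_range A" ?R] by (auto simp: rank_col_range Z_def)
  then obtain v where v: "A *v v \<notin> ?R" by (auto simp: col_range_range)
  \<comment> \<open>The part of \<open>v\<close> in the range of \<open>Z\<close> is mapped into the
    range of \<open>A ** Z\<close>, so the image of the normal part \<open>w\<close> must lie
    outside.\<close>
  obtain s w where sw: "s \<in> col_range Z" "\<And>u. u \<in> col_range Z \<Longrightarrow> orthogonal w u" "v = s + w"
    using orthogonal_subspace_decomp_exists[of "columns Z" v] unfolding col_range_def by blast
  have "A *v s \<in> ?R" using sw(1) by (auto simp: col_range_range simp flip: matrix_vector_mul_assoc)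
  then have Aw: "A *v w \<notin> ?R"
    using v R subspace_add[OF R] by (auto simp: sw(3) matrix_vector_right_distrib)
  then have "w \<noteq> 0" using subspace_0[OF R] by auto
  define y where "y = w /\<^sub>R norm w"
  have y: "normal_unit Z y"
    using \<open>w \<noteq> 0\<close> sw(2) by (auto simp: normal_unit_def y_def orthogonal_def col_range_eq span_base)
  have Ay: "A *v y \<notin> ?R"
  proof
    assume "A *v y \<in> ?R"
    then have "norm w *\<^sub>R (A *v y) \<in> ?R" using R by (simp add: subspace_scale)
    then show False using Aw \<open>w \<noteq> 0\<close> by (simp add: y_def matrix_vector_mult_scaleR)
  qed
  have "\<forall>\<^sub>F Y in at Z within stiefel. dist Y Z < e" unfolding eventually_at using e by blast
  then obtain d where d: "d > 0" "\<And>t. \<bar>t\<bar> < d \<Longrightarrow> dist (rotated Z i y t) Z < e"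
    using rotated_near[OF Z(1) y, of "\<lambda>Y. dist Y Z < e" i] e by auto
  define t where "t = min (d / 2) 1"
  have t: "0 < t" "t < pi" "\<bar>t\<bar> < d" using d(1) pi_gt3 by (auto simp: t_def min_def)
  then have sin: "sin t \<noteq> 0" using sin_gt_zero[of t] by simp
  let ?Y = "rotated Z i y t"
  let ?Q = "col_range (A ** ?Y)"
  have Q: "subspace ?Q" by (simp add: col_range_def)
  \<comment> \<open>As \<open>A\<close> kills column \<open>i\<close> of \<open>Z\<close>, the
    cosine term drops out and the image of the rotated column is a multiple of
    \<open>A *v y\<close>.\<close>
  have col: "A *v column j ?Y = (if j = i then sin t *\<^sub>R (A *v y) else A *v column j Z)" for j
    by (simp add: rotated_def column_with_column matrix_vector_right_distrib matrix_vector_mult_scaleR Az)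
  have Qcol: "A *v column j ?Y \<in> ?Q" for j
    unfolding col_range_eq column_mult by (intro span_base) auto
  have AyQ: "A *v y \<in> ?Q" using subspace_scale[OF Q Qcol[of i], of "1 / sin t"] sin by (simp add: col)
  have "?R \<subseteq> ?Q"
    unfolding col_range_eq[of "A ** Z"]
  proof (rule span_minimal[OF _ Q], safe)
    show "column j (A ** Z) \<in> ?Q" for j
      using Qcol[of j] Az subspace_0[OF Q] by (cases "j = i") (auto simp: column_mult col)
  qed
  then have "?R \<subset> ?Q" using Ay AyQ by blast
  then have "dim ?R < dim ?Q" using R Q by (intro dim_psubset) (metis span_eq_iff)
  then have "rank (A ** X) < rank (A ** ?Y)" using rk[OF U(1), of X] by (simp add: rank_col_range Z_def)
  moreover have "dist (?Y ** transpose U) X < e"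
    using d(2)[OF t(3)] dist_rotate[of "transpose U" ?Y Z] U(1) by (simp add: Z_def)
  moreover have "?Y ** transpose U \<in> stiefel"
    using rotated_stiefel[OF Z(1) y] U(1) by (intro stiefel_rotate) auto
  ultimately show ?thesis
    using rk[of "transpose U" ?Y] U(1) by (intro bexI[of _ "?Y ** transpose U"]) auto
qed

text \<open>Rank raising is iterated, by induction on the deficit; each round spends half of the
  tolerance and leaves the other half to the later ones.\<close>

lemma nearby_high_rank:
  fixes X :: "real^'p^'n" and A :: "real^'n^'m"
  assumes "X \<in> stiefel" "q \<le> CARD('p)" "q \<le> rank A" "e > 0"
  shows "\<exists>Y\<in>stiefel. dist Y X < e \<and> q \<le> rank (A ** Y)"
  using assms
proof (induction "q - rank (A ** X)" arbitrary: X e rule: less_induct)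
  case less
  show ?case
  proof (cases "q \<le> rank (A ** X)")
    case True
    then show ?thesis using less.prems by (intro bexI[of _ X]) auto
  next
    case False
    then obtain Y where Y: "Y \<in> stiefel" "dist Y X < e / 2" "rank (A ** X) < rank (A ** Y)"
      using raise_rank[OF less.prems(1), of A "e / 2"] less.prems by auto
    then obtain W where W: "W \<in> stiefel" "dist W Y < e / 2" "q \<le> rank (A ** W)"
      using less.hyps[OF _ Y(1) less.prems(2,3), of "e / 2"] False less.prems(4) Y(3)
      by (meson diff_less_mono2 half_gt_zero not_le)
    have "dist W X < e" using dist_triangle[of W X Y] W(2) Y(2) by simp
    then show ?thesis using W by blast
  qed
qed

lemma local_max_positive:
  fixes X :: "real^'p^'n" and A :: "real^'n^'m"
  assumes X: "local_max A q X" and q: "q \<le> CARD('p)" "q \<le> rank A"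
  shows "sym_eig q (transpose X ** gram A ** X) > 0"
proof (rule ccontr)
  assume np: "\<not> ?thesis"
  have St: "X \<in> stiefel" using X by (simp add: local_max_def)
  obtain d where d: "d > 0" "\<And>Y. Y \<in> stiefel \<Longrightarrow> Y \<noteq> X \<Longrightarrow> dist Y X < d \<Longrightarrow> objective A q Y \<le> objective A q X"
    using X unfolding local_max_def eventually_at by blast
  obtain Y where Y: "Y \<in> stiefel" "dist Y X < d" "q \<le> rank (A ** Y)"
    using nearby_high_rank[OF St q d(1)] by blast
  have pos: "sym_eig q (transpose Y ** gram A ** Y) > 0"
    using Y(3) by (simp add: compression_gram sym_eig_gram_pos_iff)
  then have "Y \<noteq> X" using np by blast
  from d(2)[OF Y(1) this Y(2)] have "sym_eig q (transpose Y ** gram A ** Y) \<le> sym_eig q (transpose X ** gram A ** X)"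
    using binomial_pos_real[OF q(1)] by (simp add: objective_stiefel St Y(1) divide_le_cancel)
  then show False using np pos by linarith
qed

lemma local_max_imp_global_max:
  fixes X :: "real^'p^'n" and A :: "real^'n^'m"
  assumes X: "local_max A q X" and q: "q \<ge> 1" "q \<le> CARD('p)"
  shows "global_max A q X"
proof (cases "q \<le> rank A")
  case True
  then show ?thesis
    using local_max_positive_dominant[OF X q local_max_positive[OF X q(2) True]] X
    by (intro dominant_global_max) (auto simp: local_max_def)
next
  case False
  \<comment> \<open>Every \<open>A ** Y\<close> has rank below q, so the objective is 0 on the whole
    Stiefel manifold and every frame is a global maximum.\<close>
  have "sym_eig q (gram (A ** Y)) = 0" for Y :: "real^'p^'n"
    using sym_eig_gram_pos_iff[of q "A ** Y"] sym_eig_gram_nonneg[of q "A ** Y"] rank_mult_le[of A Y] False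
    by linarith
  then show ?thesis
    using X by (simp add: global_max_iff local_max_def objective_stiefel compression_gram)
qed

lemma zero_global_min:
  fixes X :: "real^'p^'n" and A :: "real^'n^'m"
  assumes "X \<in> stiefel" "\<not> sym_eig q (transpose X ** gram A ** X) > 0"
  shows "global_min A q X"
proof -
  have "sym_eig q (transpose X ** gram A ** X) = 0"
    using assms(2) sym_eig_gram_nonneg[of q "A ** X"] by (simp add: compression_gram)
  then show ?thesis
    using assms(1) by (auto simp: global_min_iff objective_stiefel compression_gram sym_eig_gram_nonneg)
qed

lemma local_min_imp_global_min:
  fixes X :: "real^'p^'n" and A :: "real^'n^'m"
  assumes X: "local_min A q X" and q: "q \<ge> 1" "q \<le> CARD('p)"
  shows "global_min A q X"
  using zero_global_min[of X q A] local_min_positive_antidominant[OF X q] antidominant_global_min X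
  unfolding local_min_def by blast

section \<open>Leading singular factors\<close>

lemma eigenvalue_list_sorted:
  assumes "i \<le> j" "j < length (eigenvalue_list B)"
  shows "eigenvalue_list B ! j \<le> eigenvalue_list B ! i"
proof -
  let ?s = "sorted_list_of_multiset (proots (char_polynomial B))"
  have "?s ! (length ?s - Suc j) \<le> ?s ! (length ?s - Suc i)"
    using assms by (intro sorted_nth_mono) (auto simp: eigenvalue_list_def)
  then show ?thesis using assms by (simp add: eigenvalue_list_def rev_nth)
qed

text \<open>By invariance \<open>M *v column i Z\<close> expands in the columns of \<open>Z\<close>,
  with coefficients read from the compression. This is the route to eigenvectors when dominance or a
  full range is given instead of criticality.\<close>

lemma invariant_columns_eigenvectors:
  fixes Z :: "real^'p^'n"
  assumes Z: "Z \<in> stiefel" and diag: "transpose Z ** M ** Z = diag_matrix b"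
    and inv: "\<And>v. v \<in> col_range Z \<Longrightarrow> M *v v \<in> col_range Z"
  shows "M *v column i Z = b i *\<^sub>R column i Z"
proof -
  have z: "orthonormal_on UNIV (\<lambda>j. column j Z)" using Z by (simp add: stiefel_iff)
  have "column i Z \<in> col_range Z" unfolding col_range_eq by (intro span_base) auto
  then have "M *v column i Z = (\<Sum>j\<in>UNIV. ((M *v column i Z) \<bullet> column j Z) *\<^sub>R column j Z)"
    using inv by (intro orthonormal_on_expand[OF z]) (auto simp: col_range_eq)
  also have "\<dots> = (\<Sum>j\<in>UNIV. if j = i then b i *\<^sub>R column i Z else 0)"
    using inner_column_eigen[OF diag] by (intro sum.cong refl) (simp add: inner_commute[of "M *v _"])
  finally show ?thesis by simp
qed

lemma dim_col_range_stiefel: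
  assumes "(Z :: real^'p^'n) \<in> stiefel"
  shows "dim (col_range Z) = CARD('p)"
  using assms orthonormal_on_dim[of UNIV "\<lambda>i. column i Z"] by (simp add: stiefel_iff col_range_eq)

text \<open>A square frame spans everything, so no unit vector is normal to it and the eigenvalue
  bound holds vacuously.\<close>

lemma stiefel_square_dominant:
  fixes X :: "real^'p^'n"
  assumes X: "X \<in> stiefel" and card: "CARD('p) = CARD('n)" and M: "transpose M = M"
  shows "dominant_subspace M (col_range X)"
proof -
  obtain U b where U: "orthogonal_matrix U" "X ** U \<in> stiefel"
    "transpose (X ** U) ** M ** (X ** U) = diag_matrix b"
    using stiefel_diagonalise[OF X M] by blast
  have univ: "col_range (X ** U) = UNIV"
    using dim_col_range_stiefel[OF U(2)] card dim_eq_full[of "columns (X ** U)"]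
    by (simp add: col_range_def)
  have "dominant_subspace M (col_range (X ** U))"
  proof (rule dominant_subspaceI[OF M U(2)])
    show "M *v column j (X ** U) = b j *\<^sub>R column j (X ** U)" for j
      using invariant_columns_eigenvectors[OF U(2,3)] univ by simp
    fix i y \<mu> assume y: "normal_unit (X ** U) y"
    have "y \<in> span (range (\<lambda>i. column i (X ** U)))" using univ by (simp add: col_range_eq)
    then have "orthogonal y y"
      by (rule orthogonal_to_span) (use y in \<open>auto simp: normal_unit_def orthogonal_def\<close>)
    then have "y = 0" by (simp add: orthogonal_def)
    then show "\<mu> \<le> b i" using y by (simp add: normal_unit_def)
  qed
  then show ?thesis using U(1) by (simp add: col_range_rotate)
qed

text \<open>The eigenvectors follow the decreasing order of the eigenvalue list, repeated values
  included. Dominance of the whole space is added so that the counting lemma accepts this system as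
  its family \<open>x\<close>.\<close>

lemma gram_eigensystem:
  fixes A :: "real^'n^'m"
  obtains w :: "nat \<Rightarrow> real^'n" where
    "length (eigenvalue_list (gram A)) = CARD('n)" "orthonormal_on {..<CARD('n)} w"
    "span (w ` {..<CARD('n)}) = UNIV" "dominant_subspace (gram A) (UNIV :: (real^'n) set)"
    "\<And>k. k < CARD('n) \<Longrightarrow> gram A *v w k = eigenvalue_list (gram A) ! k *\<^sub>R w k"
proof -
  let ?l = "eigenvalue_list (gram A)"
  obtain W d where W: "orthogonal_matrix W" "transpose W ** gram A ** W = diag_matrix d"
    using symmetric_diagonalise[OF transpose_gram] by blast
  have WS: "W \<in> stiefel" using W(1) by (simp add: stiefel_def orthogonal_matrix_def)
  have univ: "col_range W = UNIV"
    using dim_col_range_stiefel[OF WS] dim_eq_full[of "columns W"] by (simp add: col_range_def)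
  have eig: "gram A *v column i W = d i *\<^sub>R column i W" for i
    using invariant_columns_eigenvectors[OF WS W(2)] univ by simp
  have "mset ?l = image_mset d (mset_set UNIV)"
    by (metis W eigenvalue_list_orthogonal_conj mset_eigenvalue_list_diag)
  then obtain f where f: "bij_betw f {..<length ?l} (UNIV :: 'n set)" "\<And>k. k < length ?l \<Longrightarrow> ?l ! k = d (f k)"
    using mset_enumeration[of UNIV ?l d] by auto
  have len: "length ?l = CARD('n)" using bij_betw_same_card[OF f(1)] by simp
  define w where "w k = column (f k) W" for k
  have "orthonormal_on {..<CARD('n)} w"
    using WS f(1) len by (auto simp: stiefel_iff orthonormal_on_def w_def bij_betw_def inj_on_def)
  moreover have "w ` {..<CARD('n)} = range (\<lambda>i. column i W)"
  proof -
    have "w ` {..<CARD('n)} = (\<lambda>i. column i W) ` f ` {..<CARD('n)}" by (simp add: w_def image_image)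
    then show ?thesis using f(1) len by (simp add: bij_betw_def)
  qed
  then have "span (w ` {..<CARD('n)}) = UNIV" using univ by (simp add: col_range_eq)
  moreover have wl: "gram A *v w k = ?l ! k *\<^sub>R w k" if "k < CARD('n)" for k
    using that f(2) len eig by (simp add: w_def)
  moreover have "dominant_subspace (gram A) (UNIV :: (real^'n) set)"
    using stiefel_square_dominant[OF WS refl transpose_gram, of A] univ by simp
  ultimately show ?thesis using that len by blast
qed

lemma singular_value_squared:
  fixes A :: "real^'n^'m"
  assumes k: "k < CARD('n)"
  shows "(singular_values A ! k)\<^sup>2 = eigenvalue_list (gram A) ! k"
proof -
  obtain w :: "nat \<Rightarrow> real^'n" where w: "length (eigenvalue_list (gram A)) = CARD('n)"
    "orthonormal_on {..<CARD('n)} w" "span (w ` {..<CARD('n)}) = UNIV"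
    "dominant_subspace (gram A) (UNIV :: (real^'n) set)"
    "\<And>k. k < CARD('n) \<Longrightarrow> gram A *v w k = eigenvalue_list (gram A) ! k *\<^sub>R w k"
    by (rule gram_eigensystem[of A]) (rule that)
  have "w k \<bullet> w k = 1" using w(2) k by (simp add: orthonormal_on_def)
  then have "0 \<le> eigenvalue_list (gram A) ! k" using gram_form_nonneg[of "w k" A] w(5)[OF k] by simp
  then show ?thesis using k w(1) by (simp add: singular_values_def flip: gram_def)
qed

lemma leading_columns:
  fixes V :: "real^'p^'n"
  assumes "leading_right_singular_factor A V" "CARD('p) \<le> CARD('n)"
  obtains \<sigma> where "V \<in> stiefel" "bij_betw \<sigma> UNIV {..<CARD('p)}"
    "\<And>j. gram A *v column j V = eigenvalue_list (gram A) ! \<sigma> j *\<^sub>R column j V"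
proof -
  obtain \<sigma> where V: "V \<in> stiefel" and \<sigma>: "bij_betw \<sigma> UNIV {..<CARD('p)}"
    "\<And>j. gram A *v column j V = (singular_values A ! \<sigma> j)\<^sup>2 *\<^sub>R column j V"
    using assms(1) by (auto simp: leading_right_singular_factor_def gram_def)
  have "\<sigma> j < CARD('n)" for j using bij_betwE[OF \<sigma>(1)] assms(2) by (auto intro: less_le_trans)
  then show ?thesis using that[OF V \<sigma>(1)] \<sigma>(2) by (simp add: singular_value_squared)
qed

lemma leadingI:
  fixes V :: "real^'p^'n"
  assumes "V \<in> stiefel" "bij_betw \<sigma> UNIV {..<CARD('p)}" "CARD('p) \<le> CARD('n)"
    "\<And>j. gram A *v column j V = eigenvalue_list (gram A) ! \<sigma> j *\<^sub>R column j V"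
  shows "leading_right_singular_factor A V"
proof -
  have "\<sigma> j < CARD('n)" for j using bij_betwE[OF assms(2)] assms(3) by (auto intro: less_le_trans)
  then show ?thesis
    using assms by (auto simp: leading_right_singular_factor_def singular_value_squared simp flip: gram_def)
qed

lemma leading_exists:
  fixes A :: "real^'n^'m"
  assumes "CARD('p::finite) \<le> CARD('n)"
  obtains V :: "real^'p^'n" where "leading_right_singular_factor A V"
proof -
  obtain \<sigma> :: "'p \<Rightarrow> nat" where \<sigma>: "bij_betw \<sigma> UNIV {..<CARD('p)}"
    using ex_bij_betw_finite_nat[of "UNIV :: 'p set"] by (auto simp: atLeast0LessThan)
  obtain w :: "nat \<Rightarrow> real^'n" where w: "length (eigenvalue_list (gram A)) = CARD('n)"
    "orthonormal_on {..<CARD('n)} w" "span (w ` {..<CARD('n)}) = UNIV"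
    "dominant_subspace (gram A) (UNIV :: (real^'n) set)"
    "\<And>k. k < CARD('n) \<Longrightarrow> gram A *v w k = eigenvalue_list (gram A) ! k *\<^sub>R w k"
    by (rule gram_eigensystem[of A]) (rule that)
  have \<sigma>n: "\<sigma> j < CARD('n)" for j using bij_betwE[OF \<sigma>] assms by (auto intro: less_le_trans)
  define V :: "real^'p^'n" where "V = (\<chi> a j. w (\<sigma> j) $ a)"
  have col: "column j V = w (\<sigma> j)" for j by (simp add: V_def column_def)
  have "V \<in> stiefel"
    using w(2) \<sigma> \<sigma>n by (auto simp: stiefel_iff orthonormal_on_def col bij_betw_def inj_on_def)
  then have "leading_right_singular_factor A V"
    using w(5)[OF \<sigma>n] by (intro leadingI[OF _ \<sigma> assms]) (simp_all add: col)
  then show ?thesis using that by blast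
qed

text \<open>If a normal eigenvalue \<mu> exceeded \<open>?l ! \<sigma> i\<close>, the frame enlarged
  by its eigenvector would have one more entry that is at least \<mu>, and the list would need as
  many such positions. But all of these precede \<open>\<sigma> i\<close> by sortedness and are
  already taken by columns of \<open>V\<close>.\<close>

lemma leading_dominant:
  fixes V :: "real^'p^'n"
  assumes lead: "leading_right_singular_factor A V" and pn: "CARD('p) \<le> CARD('n)"
  shows "dominant_subspace (gram A) (col_range V)"
proof -
  let ?l = "eigenvalue_list (gram A)"
  obtain \<sigma> where V: "V \<in> stiefel" and \<sigma>: "bij_betw \<sigma> UNIV {..<CARD('p)}"
    and eig: "\<And>j. gram A *v column j V = ?l ! \<sigma> j *\<^sub>R column j V"
    using leading_columns[OF lead pn] by blast
  obtain w :: "nat \<Rightarrow> real^'n" where len: "length ?l = CARD('n)" and w: "orthonormal_on {..<CARD('n)} w"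
    "span (w ` {..<CARD('n)}) = UNIV" "dominant_subspace (gram A) (UNIV :: (real^'n) set)"
    "\<And>k. k < CARD('n) \<Longrightarrow> gram A *v w k = ?l ! k *\<^sub>R w k"
    by (rule gram_eigensystem[of A]) (rule that)
  show ?thesis
  proof (rule dominant_subspaceI[OF transpose_gram V eig])
    fix i y \<mu> assume y: "normal_unit V y" "gram A *v y = \<mu> *\<^sub>R y"
    show "\<mu> \<le> ?l ! \<sigma> i"
    proof (rule ccontr)
      assume "\<not> \<mu> \<le> ?l ! \<sigma> i"
      then have less: "?l ! \<sigma> i < \<mu>" by simp
      \<comment> \<open>\<open>None\<close> indexes the additional eigenvector \<open>y\<close>, so
        that \<open>'p option\<close> counts one more than the columns.\<close>
      define x where "x o' = (case o' of None \<Rightarrow> y | Some j \<Rightarrow> column j V)" for o'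
      define c where "c o' = (case o' of None \<Rightarrow> \<mu> | Some j \<Rightarrow> ?l ! \<sigma> j)" for o'
      have x: "orthonormal_on UNIV x"
        using V y(1) by (auto simp: orthonormal_on_def x_def stiefel_iff normal_unit_def norm_eq_1
            inner_commute split: option.splits)
      have xM: "gram A *v x o' = c o' *\<^sub>R x o'" for o'
        by (auto simp: x_def c_def y(2) eig split: option.splits)
      have fin: "finite (UNIV :: 'p option set)" by simp
      have "card (UNIV :: 'p option set) \<le> card {..<CARD('n)}"
        using orthonormal_on_dim[OF x fin] dim_subset_UNIV[of "span (range x)"] by simp
      then have "card {o'\<in>UNIV. \<mu> \<le> c o'} \<le> card {k\<in>{..<CARD('n)}. \<mu> \<le> ?l ! k}"
        using w x xM
        by (intro dominant_subspace_count[OF transpose_gram w(3) w(1) _ w(2) _ x fin])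
          (auto simp: orthonormal_on_def)
      moreover have "{o'\<in>UNIV. \<mu> \<le> c o'} = insert None (Some ` {j. \<mu> \<le> ?l ! \<sigma> j})"
        unfolding c_def by (auto split: option.splits simp: image_iff) (metis option.exhaust)
      moreover have "card (insert None (Some ` {j. \<mu> \<le> ?l ! \<sigma> j})) = Suc (card {j. \<mu> \<le> ?l ! \<sigma> j})"
        by (simp add: card_image)
      moreover have "card {k\<in>{..<CARD('n)}. \<mu> \<le> ?l ! k} \<le> card {j. \<mu> \<le> ?l ! \<sigma> j}"
      proof -
        have "{k\<in>{..<CARD('n)}. \<mu> \<le> ?l ! k} \<subseteq> \<sigma> ` {j. \<mu> \<le> ?l ! \<sigma> j}"
        proof
          fix k assume k: "k \<in> {k\<in>{..<CARD('n)}. \<mu> \<le> ?l ! k}"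
          have "\<sigma> i < CARD('p)" using \<sigma> by (auto simp: bij_betw_def)
          have "k < \<sigma> i"
          proof (rule ccontr)
            assume "\<not> k < \<sigma> i"
            then have "?l ! k \<le> ?l ! \<sigma> i" using k len by (intro eigenvalue_list_sorted) auto
            then show False using k less by simp
          qed
          then have "k \<in> range \<sigma>" using \<sigma> \<open>\<sigma> i < CARD('p)\<close> by (simp add: bij_betw_def)
          then show "k \<in> \<sigma> ` {j. \<mu> \<le> ?l ! \<sigma> j}" using k by auto
        qed
        from card_mono[OF finite_imageI[OF finite] this] show ?thesis
          using card_image_le[OF finite[of "{j. \<mu> \<le> ?l ! \<sigma> j}"], of \<sigma>] by linarith
      qed
      ultimately show False by simp
    qed
  qed
qed

text \<open>Mutual domination forces equal sums, and termwise inequalities between families with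
  equal sums are equalities.\<close>

lemma sum_bij_eq:
  fixes f g :: "'i::finite \<Rightarrow> real"
  assumes "bij \<pi>" "\<And>i. f i \<le> g (\<pi> i)" "bij \<rho>" "\<And>i. g i \<le> f (\<rho> i)"
  shows "f i = g (\<pi> i)"
proof -
  have "sum g UNIV \<le> (\<Sum>i\<in>UNIV. f (\<rho> i))" using assms(4) by (intro sum_mono)
  also have "\<dots> = sum f UNIV" using sum.reindex_bij_betw[of \<rho> UNIV UNIV f] assms(3) by simp
  finally have "sum g UNIV \<le> sum f UNIV" .
  moreover have "(\<Sum>i\<in>UNIV. g (\<pi> i)) = sum g UNIV"
    using sum.reindex_bij_betw[of \<pi> UNIV UNIV g] assms(1) by simp
  moreover have "sum f UNIV \<le> (\<Sum>i\<in>UNIV. g (\<pi> i))" using assms(2) by (intro sum_mono)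
  ultimately have "sum f UNIV = (\<Sum>i\<in>UNIV. g (\<pi> i))" by linarith
  then show ?thesis using assms(2) by (intro sum_mono_inv[of f UNIV "\<lambda>i. g (\<pi> i)"]) auto
qed

text \<open>The given range and that of some leading factor are both dominant, so their eigenvalues
  dominate each other and agree up to a bijection. With ties at the cut the two ranges may differ;
  hence the witness is the rotated frame itself, not that factor.\<close>

lemma dominant_leading:
  fixes X :: "real^'p^'n"
  assumes X: "X \<in> stiefel" and dom: "dominant_subspace (gram A) (col_range X)" and pn: "CARD('p) \<le> CARD('n)"
  shows "\<exists>V :: real^'p^'n. leading_right_singular_factor A V \<and> col_range X = col_range V"
proof -
  let ?l = "eigenvalue_list (gram A)"
  obtain U b where U: "orthogonal_matrix U" "X ** U \<in> stiefel"
    "transpose (X ** U) ** gram A ** (X ** U) = diag_matrix b"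
    using stiefel_diagonalise[OF X transpose_gram] by blast
  have range: "col_range (X ** U) = col_range X" using U(1) by (simp add: col_range_rotate)
  have eig: "gram A *v column j (X ** U) = b j *\<^sub>R column j (X ** U)" for j
    using invariant_columns_eigenvectors[OF U(2,3)] dom range by (auto simp: dominant_subspace_def)
  obtain V :: "real^'p^'n" where lead: "leading_right_singular_factor A V"
    using leading_exists[OF pn] by blast
  obtain \<sigma> where V: "V \<in> stiefel" and \<sigma>: "bij_betw \<sigma> UNIV {..<CARD('p)}"
    and Veig: "\<And>j. gram A *v column j V = ?l ! \<sigma> j *\<^sub>R column j V"
    using leading_columns[OF lead pn] by blast
  have Vdiag: "transpose V ** gram A ** V = diag_matrix (\<lambda>j. ?l ! \<sigma> j)"
    using V by (simp add: vec_eq_iff compression_nth Veig stiefel_iff orthonormal_on_def diag_matrix_nth)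
  obtain \<pi> where \<pi>: "bij \<pi>" "\<And>j. b j \<le> ?l ! \<sigma> (\<pi> j)"
    using dominant_bijection[OF transpose_gram leading_dominant[OF lead pn] V Vdiag U(2,3)] by blast
  obtain \<rho> where \<rho>: "bij \<rho>" "\<And>j. ?l ! \<sigma> j \<le> b (\<rho> j)"
    using dominant_bijection[OF transpose_gram dom[folded range] U(2,3) V Vdiag] by blast
  have "b j = ?l ! \<sigma> (\<pi> j)" for j
    using sum_bij_eq[of \<pi> b "\<lambda>j. ?l ! \<sigma> j" \<rho>] \<pi> \<rho> by blast
  then have "leading_right_singular_factor A (X ** U)"
    using eig \<pi>(1) bij_betw_trans[OF \<pi>(1) \<sigma>] by (intro leadingI[OF U(2) _ pn, of "\<sigma> \<circ> \<pi>"]) auto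
  then show ?thesis using range by metis
qed

text \<open>For q at most the rank the numerator is positive and the local theory applies; for A = 0
  the form vanishes and the threshold 0 works; a square frame has full range.\<close>

lemma global_max_dominant:
  fixes X :: "real^'p^'n" and A :: "real^'n^'m"
  assumes X: "global_max A q X" and q: "q \<ge> 1" "q \<le> CARD('p)"
    and cases: "q \<le> rank A \<or> A = 0 \<or> CARD('p) = CARD('n)"
  shows "dominant_subspace (gram A) (col_range X)"
proof -
  have St: "X \<in> stiefel" using X by (simp add: global_max_iff)
  have lm: "local_max A q X" using X by (rule global_max_imp_local_max)
  consider "q \<le> rank A" | "A = 0" | "CARD('p) = CARD('n)" using cases by blast
  then show ?thesis
  proof cases
    case 1
    then show ?thesis using local_max_positive_dominant[OF lm q local_max_positive[OF lm q(2)]] by blast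
  next
    case 2
    \<comment> \<open>The squared length of \<open>gram A *v v\<close> is an inner product with
      \<open>A *v v\<close>, which is 0.\<close>
    then have "gram A *v v = 0" for v
      using gram_form[of "gram A *v v" A v] by simp
    then show ?thesis
      by (auto simp: dominant_subspace_def col_range_def span_zero intro!: exI[of _ 0])
  next
    case 3
    then show ?thesis using stiefel_square_dominant[OF St] by simp
  qed
qed

section \<open>Saddle points\<close>

text \<open>In contrast to a rotation, the straight line lengthens column \<open>i\<close>, so the
  denominator of the objective varies. Its effect is cancelled by one part of the multiplier entry,
  and the other part turns \<mu> into \<mu> - b i.\<close>

lemma stationary_ascent_direction:
  fixes Z :: "real^'p^'n"
  assumes Z: "Z \<in> stiefel" and y: "normal_unit Z y" and q: "q \<ge> 1" "q \<le> CARD('p)"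
    and eig: "\<And>j. gram A *v column j Z = b j *\<^sub>R column j Z" and ym: "gram A *v y = \<mu> *\<^sub>R y"
    and L: "lagrange_multiplier A q Z \<Lambda>"
    and pos: "esym (q - 1) (UNIV - {i}) b > 0" and gap: "b i < \<mu>"
  shows "ascent_direction A q Z (column_matrix i y)"
proof -
  \<comment> \<open>\<open>E\<close> and \<open>C\<close> are the numerator and denominator of the
    objective at \<open>Z\<close>; \<epsilon> and \<open>S\<close> are their slopes in entry (i, i)
    of the compression and of the Gram matrix; \<kappa> is the only multiplier entry that is
    met.\<close>
  define one :: "'p \<Rightarrow> real" where "one = (\<lambda>_. 1)"
  define \<epsilon> where "\<epsilon> = esym (q - 1) (UNIV - {i}) b"
  define E where "E = esym q (UNIV - {i}) b + b i * \<epsilon>"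
  define S where "S = esym (q - 1) (UNIV - {i}) one"
  define C where "C = esym q (UNIV - {i}) one + S"
  define \<kappa> where "\<kappa> = \<Lambda> $ i $ i"
  have z: "column j Z \<bullet> column k Z = (if j = k then 1 else 0)" for j k
    using Z by (auto simp: stiefel_iff orthonormal_on_def)
  have y': "y \<bullet> y = 1" "y \<bullet> column j Z = 0" "column j Z \<bullet> y = 0" for j
    using y by (auto simp: normal_unit_def norm_eq_1 inner_commute)
  have S0: "S \<ge> 0" unfolding S_def one_def by (intro esym_nonneg) auto
  have C: "C > 0"
  proof -
    have "esym q UNIV one > 0" unfolding one_def using q by (subst esym_pos_iff) auto
    moreover have "esym q UNIV one = C"
      using esym_update[OF q(1), of one i 1] by (simp add: C_def S_def one_def fun_upd_idem)
    ultimately show ?thesis by simp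
  qed
  have path: "Z + column_matrix i (v - column i Z) = with_column Z i v" for v
    by (simp add: with_column_def)
  \<comment> \<open>Both coefficients stay free: s = 1 + t without \<open>y\<close> gives the radial
    line that determines \<kappa>, and s = 1 the tangent line of the Lagrangian.\<close>
  have gramZ: "transpose (with_column Z i v) ** gram A ** with_column Z i v =
      diag_matrix (b(i := s\<^sup>2 * b i + t\<^sup>2 * \<mu>))" (is ?M)
    and Z2: "transpose (with_column Z i v) ** with_column Z i v = diag_matrix (one(i := s\<^sup>2 + t\<^sup>2))" (is ?I)
    if v: "v = s *\<^sub>R column i Z + t *\<^sub>R y" for v s t
  proof -
    show ?M unfolding v
      by (simp add: vec_eq_iff compression_nth column_with_column matrix_vector_right_distrib
          matrix_vector_mult_scaleR eig ym inner_add_left inner_add_right z y' diag_matrix_nth power2_eq_square)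
    show ?I unfolding v one_def
      by (simp add: vec_eq_iff transpose_mult_nth column_with_column
          inner_add_left inner_add_right z y' diag_matrix_nth power2_eq_square)
  qed
  have obj: "objective A q (with_column Z i (s *\<^sub>R column i Z + t *\<^sub>R y)) =
      (E + (s\<^sup>2 - 1) * b i * \<epsilon> + t\<^sup>2 * \<mu> * \<epsilon>) / (C + (s\<^sup>2 - 1 + t\<^sup>2) * S)" for s t
    unfolding objective_eq gramZ[OF refl] Z2[OF refl] sym_eig_diag esym_update[OF q(1)]
    by (simp add: E_def C_def S_def \<epsilon>_def algebra_simps)

  obtain G where G: "GDERIV (objective A q) Z :> G" "G + 2 *\<^sub>R (Z ** \<Lambda>) = 0"
    using L by (auto simp: lagrange_multiplier_def)
  text \<open>The multiplier entry is read off by comparing the derivative of the objective in the radial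
    direction of the \<open>i\<close>-th column with the Lagrange condition.\<close>
  have \<kappa>: "\<kappa> * C\<^sup>2 = E * S - b i * \<epsilon> * C"
  proof -
    have "((\<lambda>t. Z + t *\<^sub>R column_matrix i (column i Z)) has_derivative (\<lambda>t. t *\<^sub>R column_matrix i (column i Z))) (at 0)"
      by (auto intro!: derivative_eq_intros)
    from has_derivative_compose[OF this, of "objective A q" "\<lambda>h. h \<bullet> G"] G(1)
    have "((\<lambda>t. objective A q (Z + t *\<^sub>R column_matrix i (column i Z))) has_real_derivative
        column_matrix i (column i Z) \<bullet> G) (at 0)"
      by (simp add: gderiv_def has_field_derivative_def mult_commute_abs)
    moreover have "objective A q (Z + t *\<^sub>R column_matrix i (column i Z)) =
        (E + ((1 + t)\<^sup>2 - 1) * b i * \<epsilon>) / (C + ((1 + t)\<^sup>2 - 1) * S)" for t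
    proof -
      have "Z + t *\<^sub>R column_matrix i (column i Z) = with_column Z i ((1 + t) *\<^sub>R column i Z + 0 *\<^sub>R y)"
        by (simp add: with_column_def linear_cmul[OF linear_column_matrix, symmetric] algebra_simps)
      then show ?thesis using obj[of "1 + t" 0] by simp
    qed
    ultimately have "((\<lambda>t. (E + ((1 + t)\<^sup>2 - 1) * b i * \<epsilon>) / (C + ((1 + t)\<^sup>2 - 1) * S)) has_real_derivative
        column_matrix i (column i Z) \<bullet> G) (at 0)"
      by simp
    moreover have "((\<lambda>t. (E + ((1 + t)\<^sup>2 - 1) * b i * \<epsilon>) / (C + ((1 + t)\<^sup>2 - 1) * S)) has_real_derivative
        (2 * b i * \<epsilon> * C - E * (2 * S)) / C\<^sup>2) (at 0)"
      using C by (auto intro!: derivative_eq_intros simp: power2_eq_square)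
    ultimately have "column_matrix i (column i Z) \<bullet> G = (2 * b i * \<epsilon> * C - E * (2 * S)) / C\<^sup>2"
      by (rule DERIV_unique)
    moreover have "column_matrix i (column i Z) \<bullet> G = - 2 * \<kappa>"
    proof -
      have "G = - 2 *\<^sub>R (Z ** \<Lambda>)" using G(2) by (simp add: eq_neg_iff_add_eq_0)
      moreover have "column i Z \<bullet> column i (Z ** \<Lambda>) = \<kappa>"
      proof -
        have "column i Z \<bullet> column i (Z ** \<Lambda>) = (transpose Z ** (Z ** \<Lambda>)) $ i $ i"
          by (simp add: transpose_mult_nth)
        also have "transpose Z ** (Z ** \<Lambda>) = \<Lambda>" using Z by (simp add: stiefel_def matrix_mul_assoc)
        finally show ?thesis by (simp add: \<kappa>_def)
      qed
      ultimately show ?thesis by (simp add: inner_column_matrix[of i _ "Z ** \<Lambda>"])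
    qed
    ultimately show ?thesis using C by (simp add: field_simps)
  qed

  \<comment> \<open>This is the quotient rule after the terms cubic in \<open>t\<close> have
    cancelled.\<close>
  define \<phi> where "\<phi> t = 2 * t * (\<mu> * \<epsilon> * C - E * S) / (C + t\<^sup>2 * S)\<^sup>2 + 2 * t * \<kappa>" for t
  have Cpos: "C + t\<^sup>2 * S > 0" for t using C S0 by (simp add: add_pos_nonneg)
  have Lag: "lagrangian A q \<Lambda> (Z + t *\<^sub>R column_matrix i y) =
      (E + t\<^sup>2 * \<mu> * \<epsilon>) / (C + t\<^sup>2 * S) + t\<^sup>2 * \<kappa>" for t
  proof -
    have eq: "Z + t *\<^sub>R column_matrix i y = with_column Z i (1 *\<^sub>R column i Z + t *\<^sub>R y)"
      by (simp add: with_column_def linear_cmul[OF linear_column_matrix])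
    \<comment> \<open>The Gram matrix departs from the identity only in entry (i, i), by t^2; hence
      the constraint term involves \<kappa> alone.\<close>
    have "diag_matrix (one(i := 1\<^sup>2 + t\<^sup>2)) - mat 1 = column_matrix i (t\<^sup>2 *\<^sub>R axis i 1)"
      by (simp add: vec_eq_iff diag_matrix_nth mat_def column_matrix_def axis_def one_def)
    then have "(transpose (Z + t *\<^sub>R column_matrix i y) ** (Z + t *\<^sub>R column_matrix i y) - mat 1) \<bullet> \<Lambda> = t\<^sup>2 * \<kappa>"
      unfolding eq Z2[OF refl] by (simp add: inner_column_matrix inner_axis' column_def \<kappa>_def)
    then show ?thesis unfolding lagrangian_def unfolding eq obj by simp
  qed
  have "((\<lambda>t. lagrangian A q \<Lambda> (Z + t *\<^sub>R column_matrix i y)) has_real_derivative \<phi> t) (at t)" for t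
    unfolding Lag
  proof (rule DERIV_cong)
    show "((\<lambda>t. (E + t\<^sup>2 * \<mu> * \<epsilon>) / (C + t\<^sup>2 * S) + t\<^sup>2 * \<kappa>) has_real_derivative
      (2 * t * \<mu> * \<epsilon> * (C + t\<^sup>2 * S) - (E + t\<^sup>2 * \<mu> * \<epsilon>) * (2 * t * S)) / ((C + t\<^sup>2 * S) * (C + t\<^sup>2 * S)) + 2 * t * \<kappa>) (at t)"
      using Cpos[of t] by (auto intro!: derivative_eq_intros)
    show "(2 * t * \<mu> * \<epsilon> * (C + t\<^sup>2 * S) - (E + t\<^sup>2 * \<mu> * \<epsilon>) * (2 * t * S)) / ((C + t\<^sup>2 * S) * (C + t\<^sup>2 * S)) + 2 * t * \<kappa> = \<phi> t"
      unfolding \<phi>_def power2_eq_square[of "C + t\<^sup>2 * S"] by (simp add: algebra_simps)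
  qed
  moreover have "(\<phi> has_real_derivative 2 * (\<mu> * \<epsilon> * C - E * S) / C\<^sup>2 + 2 * \<kappa>) (at 0)"
    unfolding \<phi>_def using C by (auto intro!: derivative_eq_intros simp: power2_eq_square)
  moreover have "2 * (\<mu> * \<epsilon> * C - E * S) / C\<^sup>2 + 2 * \<kappa> > 0"
  proof -
    \<comment> \<open>Multiplying by C^2 allows the equation for \<kappa> to be inserted; the two
      terms in E S then cancel.\<close>
    have "(2 * (\<mu> * \<epsilon> * C - E * S) / C\<^sup>2 + 2 * \<kappa>) * C\<^sup>2 = 2 * (\<mu> * \<epsilon> * C - E * S) + 2 * (\<kappa> * C\<^sup>2)"
      using C by (simp add: distrib_right)
    also have "\<dots> = 2 * ((\<mu> - b i) * \<epsilon> * C)" unfolding \<kappa> by (simp add: algebra_simps)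
    also have "\<dots> > 0" using gap pos C by (simp add: \<epsilon>_def)
    finally show ?thesis using C by (simp add: zero_less_mult_iff)
  qed
  moreover have "transpose Z ** column_matrix i y + transpose (column_matrix i y) ** Z = 0"
    by (simp add: vec_eq_iff transpose_mult_nth column_column_matrix y')
  ultimately show ?thesis
    using L unfolding ascent_direction_def
    by (intro conjI exI[of _ \<Lambda>] exI[of _ \<phi>] exI[of _ "2 * (\<mu> * \<epsilon> * C - E * S) / C\<^sup>2 + 2 * \<kappa>"]) simp_all
qed

text \<open>Not being a local minimum excludes a vanishing numerator, and not being a local maximum
  excludes dominance. The eigenvalue inequality that fails names the column and the normal
  eigenvector from which the ascent direction is built.\<close>

lemma stationary_strict_saddle:
  fixes X :: "real^'p^'n"
  assumes stat: "stationary A q X" and nmax: "\<not> local_max A q X" and nmin: "\<not> local_min A q X"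
    and q: "q \<ge> 1" "q \<le> CARD('p)"
  shows "strict_saddle_point A q X"
proof -
  have X: "X \<in> stiefel" using stat by (simp add: stationary_def)
  have pos: "sym_eig q (transpose X ** gram A ** X) > 0"
    using zero_global_min[OF X] nmin global_min_imp_local_min by blast
  obtain U b where U: "orthogonal_matrix U" "X ** U \<in> stiefel"
    "transpose (X ** U) ** gram A ** (X ** U) = diag_matrix b"
    using stiefel_diagonalise[OF X transpose_gram] by blast
  have statZ: "stationary A q (X ** U)" using stationary_rotate[OF stat U(1)] .
  then obtain \<Lambda> where L: "lagrange_multiplier A q (X ** U) \<Lambda>" by (auto simp: stationary_def)
  have pos': "esym q UNIV b > 0"
    using pos U by (metis compression_rotate sym_eig_diag sym_eig_orthogonal_conj)
  have b0: "0 \<le> b j" for j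
    using gram_form_nonneg[of "column j (X ** U)" A] inner_column_eigen[OF U(3), of j j] by simp
  have eig: "gram A *v column j (X ** U) = b j *\<^sub>R column j (X ** U)" for j
    using critical_columns_eigenvectors[OF _ U(2,3) q pos'] statZ by blast
  have "\<not> dominant_subspace (gram A) (col_range (X ** U))"
    using nmax dominant_global_max[OF X] global_max_imp_local_max U(1) by (metis col_range_rotate)
  then obtain i y \<mu> where y: "normal_unit (X ** U) y" "gram A *v y = \<mu> *\<^sub>R y" "\<not> \<mu> \<le> b i"
    using dominant_subspaceI[OF transpose_gram U(2) eig] by blast
  have "ascent_direction A q (X ** U) (column_matrix i y)"
    using stationary_ascent_direction[OF U(2) y(1) q eig y(2) L esym_remove_pos[OF q(1) b0 pos']] y(3) by simp
  from ascent_direction_rotate[OF this, of "transpose U"]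
  have "ascent_direction A q X (column_matrix i y ** transpose U)" using U(1) by simp
  then show ?thesis using stat nmax nmin by (auto simp: strict_saddle_point_def saddle_point_def)
qed

text \<open>The converse in (i) carries a case condition because it fails otherwise: if q exceeds
  the rank of a nonzero \<open>A\<close> and p < n, the objective is 0 on the whole Stiefel manifold
  and every frame is a maximiser, whereas some ranges miss part of the row space of
  \<open>A\<close>, which the range of every leading factor contains.\<close>

theorem theorem2:
  fixes A :: "real^'n^'m"
  assumes "mean_centred A"
    and "CARD('p) \<le> CARD('n)"
  shows "\<forall>q\<in>{1..CARD('p)}.
    ((\<forall>X :: real^'p^'n.
        X \<in> stiefel \<and>
        (\<exists>V :: real^'p^'n. leading_right_singular_factor A V \<and> col_range X = col_range V)
        \<longrightarrow> global_max A q X) \<and>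
     (q \<le> rank A \<or> A = 0 \<or> CARD('p) = CARD('n) \<longrightarrow>
       (\<forall>X :: real^'p^'n.
          global_max A q X \<longleftrightarrow>
          X \<in> stiefel \<and>
          (\<exists>V :: real^'p^'n. leading_right_singular_factor A V \<and> col_range X = col_range V)))) \<and>
    ((\<forall>X :: real^'p^'n. local_max A q X \<longrightarrow> global_max A q X) \<and>
     (\<forall>X :: real^'p^'n. local_min A q X \<longrightarrow> global_min A q X) \<and>
     (\<forall>X :: real^'p^'n. stationary A q X \<and> \<not> local_max A q X \<and> \<not> local_min A q X
        \<longrightarrow> strict_saddle_point A q X))"
proof (intro ballI conjI allI impI)
  fix q assume "q \<in> {1..CARD('p)}"
  then have q: "q \<ge> 1" "q \<le> CARD('p)" by auto
  have max: "global_max A q X" if "X \<in> stiefel \<and>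
      (\<exists>V :: real^'p^'n. leading_right_singular_factor A V \<and> col_range X = col_range V)"
    for X :: "real^'p^'n"
    using that leading_dominant[OF _ assms(2)] by (metis dominant_global_max)
  then show "global_max A q X" if "X \<in> stiefel \<and>
      (\<exists>V :: real^'p^'n. leading_right_singular_factor A V \<and> col_range X = col_range V)"
    for X :: "real^'p^'n"
    using that .
  show "global_max A q X \<longleftrightarrow> X \<in> stiefel \<and>
      (\<exists>V :: real^'p^'n. leading_right_singular_factor A V \<and> col_range X = col_range V)"
    if "q \<le> rank A \<or> A = 0 \<or> CARD('p) = CARD('n)" for X :: "real^'p^'n"
  proof
    assume X: "global_max A q X"
    then show "X \<in> stiefel \<and>
        (\<exists>V :: real^'p^'n. leading_right_singular_factor A V \<and> col_range X = col_range V)"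
      using dominant_leading[OF _ global_max_dominant[OF X q that] assms(2)] by (simp add: global_max_iff)
  qed (rule max)
  show "global_max A q X" if "local_max A q X" for X :: "real^'p^'n"
    using local_max_imp_global_max[OF that q] .
  show "global_min A q X" if "local_min A q X" for X :: "real^'p^'n"
    using local_min_imp_global_min[OF that q] .
  show "strict_saddle_point A q X"
    if "stationary A q X \<and> \<not> local_max A q X \<and> \<not> local_min A q X" for X :: "real^'p^'n"
    using that stationary_strict_saddle[of A q X] q by blast
qed

end
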